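(* Let $S$ be a left cancellative semigroup. There is a surjective $*$-homomorphism $h:C^*_{r,0}(I_l(S))\to C^*_r(S)$ such that $h(\Lambda_0(f))=\omega(f)$ for all $f\in I_l(S)$.
   Context: A semigroup means a set with associative product and identity element $1$. $S$ is left cancellative if $sr=st$ implies $r=t$. For $s\in S$ let $\lambda_s:S\to sS$, $\lambda_s(t)=st$. $I(S)$ is the inverse semigroup of all partially defined bijections of $S$ (product $fg$ is composition on $g^{-1}(\mathrm{dom} f)$; $f^*$ is the inverse map; the empty map is the zero $0$). $I_l(S)$ is the inverse subsemigroup of $I(S)$ generated by $\{\lambda_s\}_{s\in S}$. $\{\varepsilon_s\}$ is the canonical orthonormal basis of $\ell^2(S)$, $V_s\varepsilon_t=\varepsilon_{st}$, and $C^*_r(S)\subset B(\ell^2(S))$ is the $C^*$-algebra generated by $\{V_s:s\in S\}$. The map $\omega:I_l(S)\to B(\ell^2(S))$ is $\omega(f)\varepsilon_s=\varepsilon_{f(s)}$ if $s\in\mathrm{dom}(f)$ and $\omega(f)\varepsilon_s=0$ otherwise; it is an injective homomorphism with $\omega(\lambda_s)=V_s$. For an inverse semigroup $P$, with canonical basis $\{\delta_q\}_{q\in P}$ of $\ell^2(P)$, the left regular representation is $\Lambda(p)\delta_q=\delta_{pq}$ if $p^*pq=q$ and $\Lambda(p)\delta_q=0$ otherwise; $C^*_r(P)\subset B(\ell^2(P))$ is the closed linear span of $\Lambda(P)$. If $P=I_l(S)$ contains the empty map $0$, $C^*_{r,0}(P)=C^*_r(P)/\mathbb{C}\Lambda(0)$;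 otherwise $C^*_{r,0}(P)=C^*_r(P)$. $\Lambda_0(p)$ denotes the image of $\Lambda(p)$ in $C^*_{r,0}(P)$. *)

theory Defs
  imports "HOL-Analysis.Analysis"
begin

section \<open>The Hilbert space of square-summable functions\<close>

typedef 'a ell2 = "{x :: 'a \<Rightarrow> complex. (\<lambda>s. (cmod (x s))\<^sup>2) summable_on UNIV}"
  morphisms coord Abs_ell2
  by (rule exI[of _ "\<lambda>_. 0"]) simp

setup_lifting type_definition_ell2

lemma cmod_add_square: "(cmod (a + b))\<^sup>2 \<le> 2 * (cmod a)\<^sup>2 + 2 * (cmod b)\<^sup>2"
proof -
  have "(cmod (a + b))\<^sup>2 \<le> (cmod a + cmod b)\<^sup>2"
    by (intro power_mono norm_triangle_ineq norm_ge_zero)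
  also have "\<dots> \<le> 2 * (cmod a)\<^sup>2 + 2 * (cmod b)\<^sup>2"
    using sum_squares_bound[of "cmod a" "cmod b"] by (simp add: power2_sum)
  finally show ?thesis .
qed

lemma square_summable_add:
  assumes "(\<lambda>s. (cmod (x s))\<^sup>2) summable_on UNIV" "(\<lambda>s. (cmod (y s))\<^sup>2) summable_on UNIV"
  shows "(\<lambda>s. (cmod (x s + y s))\<^sup>2) summable_on UNIV"
  by (rule summable_on_comparison_test
      [where f = "\<lambda>s. 2 * (cmod (x s))\<^sup>2 + 2 * (cmod (y s))\<^sup>2"])
     (use assms in \<open>auto intro!: summable_on_add summable_on_cmult_right cmod_add_square\<close>)

lemma square_summable_scale:
  assumes "(\<lambda>s. (cmod (x s))\<^sup>2) summable_on UNIV"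
  shows "(\<lambda>s. (cmod (c * x s))\<^sup>2) summable_on UNIV"
  using assms by (auto simp: norm_mult power_mult_distrib intro!: summable_on_cmult_right)

lemma square_summable_prod:
  assumes "(\<lambda>s. (cmod (x s))\<^sup>2) summable_on UNIV" "(\<lambda>s. (cmod (y s))\<^sup>2) summable_on UNIV"
  shows "(\<lambda>s. cnj (x s) * y s) summable_on UNIV"
proof -
  have "(\<lambda>s. norm (cnj (x s) * y s)) summable_on UNIV"
  proof (rule summable_on_comparison_test[where f = "\<lambda>s. (cmod (x s))\<^sup>2 + (cmod (y s))\<^sup>2"])
    fix s
    have "2 * cmod (x s) * cmod (y s) \<le> (cmod (x s))\<^sup>2 + (cmod (y s))\<^sup>2"
      by (rule sum_squares_bound)
    moreover have "0 \<le> cmod (x s) * cmod (y s)" by simp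
    ultimately have "cmod (x s) * cmod (y s) \<le> (cmod (x s))\<^sup>2 + (cmod (y s))\<^sup>2"
      by linarith
    then show "norm (cnj (x s) * y s) \<le> (cmod (x s))\<^sup>2 + (cmod (y s))\<^sup>2"
      by (simp add: norm_mult)
  qed (use assms in \<open>auto intro!: summable_on_add\<close>)
  then show ?thesis by (rule abs_summable_summable)
qed

lift_definition scale_ell2 :: "complex \<Rightarrow> 'a ell2 \<Rightarrow> 'a ell2" is "\<lambda>c x s. c * x s"
  by (rule square_summable_scale)

text \<open>The inner product is conjugate linear in its first argument.\<close>

lift_definition cinner :: "'a ell2 \<Rightarrow> 'a ell2 \<Rightarrow> complex" is
  "\<lambda>x y. \<Sum>\<^sub>\<infinity>s. cnj (x s) * y s" .

instantiation ell2 :: (type) real_inner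
begin

lift_definition zero_ell2 :: "'a ell2" is "\<lambda>_. 0" by simp
lift_definition plus_ell2 :: "'a ell2 \<Rightarrow> 'a ell2 \<Rightarrow> 'a ell2" is "\<lambda>x y s. x s + y s"
  by (rule square_summable_add)
lift_definition uminus_ell2 :: "'a ell2 \<Rightarrow> 'a ell2" is "\<lambda>x s. - x s" by simp
definition minus_ell2 :: "'a ell2 \<Rightarrow> 'a ell2 \<Rightarrow> 'a ell2" where "x - y = x + (- y)" for x y :: "'a ell2"
definition scaleR_ell2 :: "real \<Rightarrow> 'a ell2 \<Rightarrow> 'a ell2" where
  "scaleR_ell2 r x = scale_ell2 (complex_of_real r) x"
definition inner_ell2 :: "'a ell2 \<Rightarrow> 'a ell2 \<Rightarrow> real" where "inner_ell2 x y = Re (cinner x y)"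
lift_definition norm_ell2 :: "'a ell2 \<Rightarrow> real" is "\<lambda>x. sqrt (\<Sum>\<^sub>\<infinity>s. (cmod (x s))\<^sup>2)" .
definition sgn_ell2 :: "'a ell2 \<Rightarrow> 'a ell2" where "sgn_ell2 x = scaleR (inverse (norm x)) x"
definition dist_ell2 :: "'a ell2 \<Rightarrow> 'a ell2 \<Rightarrow> real" where "dist_ell2 x y = norm (x - y)"
definition uniformity_ell2 :: "('a ell2 \<times> 'a ell2) filter" where
  "uniformity_ell2 = (INF e\<in>{0<..}. principal {(x, y). dist x y < e})"
definition open_ell2 :: "'a ell2 set \<Rightarrow> bool" where
  "open_ell2 U \<longleftrightarrow> (\<forall>x\<in>U. \<forall>\<^sub>F (x', y) in uniformity. x' = x \<longrightarrow> y \<in> U)"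

lemma coord_square_summable: "(\<lambda>s. (cmod (coord x s))\<^sup>2) summable_on UNIV"
  using coord[of x] by simp

lemma cinner_self: "cinner x x = complex_of_real (\<Sum>\<^sub>\<infinity>s. (cmod (coord x s))\<^sup>2)"
proof -
  have "cinner x x = (\<Sum>\<^sub>\<infinity>s. complex_of_real ((cmod (coord x s))\<^sup>2))"
    unfolding cinner.rep_eq
    by (rule infsum_cong) (simp add: complex_norm_square mult.commute del: of_real_power)
  also have "\<dots> = complex_of_real (\<Sum>\<^sub>\<infinity>s. (cmod (coord x s))\<^sup>2)"
    using has_sum_bounded_linear[OF bounded_linear_of_real
        has_sum_infsum[OF coord_square_summable[of x]]]
    by (rule infsumI[unfolded o_def])
  finally show ?thesis .
qed

lemma cinner_commute: "cinner x y = cnj (cinner y x)"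
  unfolding cinner.rep_eq infsum_cnj[symmetric] by (simp add: mult.commute)

lemma cinner_add_right: "cinner x (y + z) = cinner x y + cinner x z"
  by transfer (simp add: distrib_left infsum_add square_summable_prod)

lemma cinner_scale_right: "cinner x (scale_ell2 c y) = c * cinner x y"
proof -
  have "(\<Sum>\<^sub>\<infinity>s. cnj (coord x s) * (c * coord y s)) = (\<Sum>\<^sub>\<infinity>s. c * (cnj (coord x s) * coord y s))"
    by (simp only: mult.left_commute)
  then show ?thesis by (simp only: cinner.rep_eq scale_ell2.rep_eq infsum_cmult_right')
qed

instance
proof
  fix x y z :: "'a ell2" and r s :: real
  show "x + y + z = x + (y + z)" by transfer (simp add: add.assoc)
  show "x + y = y + x" by transfer (simp add: add.commute)
  show "0 + x = x" by transfer simp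
  show "- x + x = 0" by transfer simp
  show "x - y = x + - y" by (simp add: minus_ell2_def)
  show "r *\<^sub>R (x + y) = r *\<^sub>R x + r *\<^sub>R y"
    unfolding scaleR_ell2_def by transfer (simp add: distrib_left)
  show "(r + s) *\<^sub>R x = r *\<^sub>R x + s *\<^sub>R x"
    unfolding scaleR_ell2_def by transfer (simp add: distrib_right)
  show "r *\<^sub>R s *\<^sub>R x = (r * s) *\<^sub>R x"
    unfolding scaleR_ell2_def by transfer (simp add: mult.assoc)
  show "1 *\<^sub>R x = x" unfolding scaleR_ell2_def by transfer simp
  show "sgn x = inverse (norm x) *\<^sub>R x" by (simp add: sgn_ell2_def)
  show "dist x y = norm (x - y)" by (simp add: dist_ell2_def)
  show "(uniformity :: ('a ell2 \<times> 'a ell2) filter) = (INF e\<in>{0<..}. principal {(x, y). dist x y < e})"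
    by (simp add: uniformity_ell2_def)
  show "open U \<longleftrightarrow> (\<forall>x\<in>U. \<forall>\<^sub>F (x', y) in uniformity. x' = x \<longrightarrow> y \<in> U)" for U :: "'a ell2 set"
    by (rule open_ell2_def)
  show comm: "inner x y = inner y x" for x y :: "'a ell2"
    unfolding inner_ell2_def by (subst cinner_commute) simp
  have "inner z (x + y) = inner z x + inner z y"
    by (simp add: inner_ell2_def cinner_add_right)
  then show "inner (x + y) z = inner x z + inner y z" by (simp add: comm)
  have "inner y (r *\<^sub>R x) = r * inner y x"
    by (simp add: inner_ell2_def scaleR_ell2_def cinner_scale_right)
  then show "inner (r *\<^sub>R x) y = r * inner x y" by (simp add: comm)
  show "0 \<le> inner x x" by (simp add: inner_ell2_def cinner_self infsum_nonneg)
  show "inner x x = 0 \<longleftrightarrow> x = 0"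
  proof
    assume "inner x x = 0"
    then have 0: "(\<Sum>\<^sub>\<infinity>s. (cmod (coord x s))\<^sup>2) = 0" by (simp add: inner_ell2_def cinner_self)
    have "(cmod (coord x s))\<^sup>2 = 0" for s
      by (rule nonneg_infsum_le_0D[OF _ coord_square_summable[of x]]) (simp_all add: 0)
    then have "coord x s = 0" for s by simp
    then show "x = 0" by transfer (simp add: fun_eq_iff)
  next
    assume "x = 0"
    then show "inner x x = 0" unfolding inner_ell2_def by simp (transfer, simp)
  qed
  show "norm x = sqrt (inner x x)" by (simp add: inner_ell2_def cinner_self norm_ell2.rep_eq)
qed

end

global_interpretation ell2: vector_space "scale_ell2 :: complex \<Rightarrow> 'a ell2 \<Rightarrow> 'a ell2"
  by unfold_locales (transfer; simp add: fun_eq_iff algebra_simps)+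

lift_definition ket :: "'a \<Rightarrow> 'a ell2" is "\<lambda>s t. if t = s then 1 else 0"
proof -
  fix s :: 'a
  have "(\<lambda>t. (cmod (if t = s then 1 else 0))\<^sup>2) summable_on {s}" by simp
  then show "(\<lambda>t. (cmod (if t = s then 1 else 0))\<^sup>2) summable_on UNIV"
    by (rule summable_on_cong_neutral[THEN iffD1, rotated -1]) auto
qed

lemma cinner_ket_left: "cinner (ket s) x = coord x s"
proof -
  have "cinner (ket s) x = (\<Sum>\<^sub>\<infinity>t\<in>{s}. coord x t)"
    unfolding cinner.rep_eq ket.rep_eq by (rule infsum_cong_neutral) auto
  then show ?thesis by simp
qed

lemma norm_scale_ell2: "norm (scale_ell2 c x) = cmod c * norm x"
proof -
  have "(\<Sum>\<^sub>\<infinity>s. (cmod c)\<^sup>2 * (cmod (coord x s))\<^sup>2) = (cmod c)\<^sup>2 * (\<Sum>\<^sub>\<infinity>s. (cmod (coord x s))\<^sup>2)"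
    by (rule infsum_cmult_right')
  then show ?thesis
    by (simp add: norm_ell2.rep_eq scale_ell2.rep_eq norm_mult power_mult_distrib real_sqrt_mult)
qed

lemma cinner_scale_left: "cinner (scale_ell2 c x) y = cnj c * cinner x y"
  by (simp add: cinner_commute[of "scale_ell2 c x" y] cinner_commute[of x y] cinner_scale_right)

lemma cinner_add_left: "cinner (x + y) z = cinner x z + cinner y z"
  by (simp add: cinner_commute[of "x + y" z] cinner_commute[of x z] cinner_commute[of y z]
      cinner_add_right)

lemma cinner_self_norm: "cinner x x = complex_of_real ((norm x)\<^sup>2)"
  by (simp add: cinner_self norm_ell2.rep_eq infsum_nonneg)

lemma cmod_cinner_le: "cmod (cinner x y) \<le> norm x * norm y"
proof (cases "cinner x y = 0")
  case False
  define c where "c = cnj (cinner x y) / cmod (cinner x y)"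
  have c: "cmod c = 1" using False by (simp add: c_def norm_divide)
  have "c * cinner x y = cmod (cinner x y)"
    using False complex_norm_square[of "cinner x y"]
    by (simp add: c_def field_simps power2_eq_square)
  then have "cmod (cinner x y) = inner x (scale_ell2 c y)"
    by (simp add: inner_ell2_def cinner_scale_right)
  also have "\<dots> \<le> norm x * norm (scale_ell2 c y)" by (rule norm_cauchy_schwarz)
  finally show ?thesis by (simp add: norm_scale_ell2 c)
qed simp

lemma bounded_linear_cinner: "bounded_linear (cinner x)"
  by (rule bounded_linear_intro[where K = "norm x"])
     (simp_all add: cinner_add_right scaleR_ell2_def cinner_scale_right scaleR_conv_of_real,
      subst mult.commute, rule cmod_cinner_le)

lemma norm_ell2_le:
  assumes "\<And>F. finite F \<Longrightarrow> (\<Sum>s\<in>F. (cmod (f s))\<^sup>2) \<le> B\<^sup>2" "0 \<le> B"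
  shows "(\<lambda>s. (cmod (f s))\<^sup>2) summable_on UNIV" "norm (Abs_ell2 f) \<le> B"
proof -
  show *: "(\<lambda>s. (cmod (f s))\<^sup>2) summable_on UNIV"
    by (rule nonneg_bdd_above_summable_on, simp, rule bdd_aboveI[where M = "B\<^sup>2"])
       (use assms(1) in auto)
  have "(\<Sum>\<^sub>\<infinity>s. (cmod (f s))\<^sup>2) \<le> B\<^sup>2"
    by (rule infsum_le_finite_sums[OF *]) (rule assms)
  then show "norm (Abs_ell2 f) \<le> B"
    using * assms(2) by (simp add: norm_ell2.rep_eq Abs_ell2_inverse real_le_lsqrt infsum_nonneg)
qed

lemma coord_sum: "coord (\<Sum>s\<in>F. f s) t = (\<Sum>s\<in>F. coord (f s) t)"
  by (induction F rule: infinite_finite_induct) (simp_all add: zero_ell2.rep_eq plus_ell2.rep_eq)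

lemma coord_diff: "coord (x - y) t = coord x t - coord y t"
  unfolding minus_ell2_def plus_ell2.rep_eq uminus_ell2.rep_eq by simp

lemma coord_finite_expansion:
  assumes "finite F"
  shows "coord (\<Sum>s\<in>F. scale_ell2 (f s) (ket s)) t = (if t \<in> F then f t else 0)"
proof -
  have "coord (\<Sum>s\<in>F. scale_ell2 (f s) (ket s)) t = (\<Sum>s\<in>F. if t = s then f s else 0)"
    unfolding coord_sum by (rule sum.cong) (auto simp: scale_ell2.rep_eq ket.rep_eq)
  then show ?thesis using assms by simp
qed

lemma ell2_expansion: "((\<lambda>s. scale_ell2 (coord x s) (ket s)) has_sum x) UNIV"
proof -
  let ?q = "\<lambda>s. (cmod (coord x s))\<^sup>2"
  let ?S = "\<lambda>F. \<Sum>s\<in>F. scale_ell2 (coord x s) (ket s)"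
  have n: "norm (?S F - x) = sqrt (infsum ?q UNIV - sum ?q F)" if "finite F" for F
  proof -
    have "(\<Sum>\<^sub>\<infinity>s. (cmod (coord (?S F - x) s))\<^sup>2) = infsum ?q (UNIV - F)"
      by (rule infsum_cong_neutral) (auto simp: coord_diff coord_finite_expansion[OF that])
    also have "infsum ?q (F \<union> (UNIV - F)) = infsum ?q F + infsum ?q (UNIV - F)"
      by (rule infsum_Un_disjoint)
         (rule summable_on_subset_banach[OF coord_square_summable] subset_UNIV Diff_disjoint)+
    then have "infsum ?q (UNIV - F) = infsum ?q UNIV - sum ?q F" using that by simp
    finally show ?thesis by (simp add: norm_ell2.rep_eq)
  qed
  have "(sum ?q \<longlongrightarrow> infsum ?q UNIV) (finite_subsets_at_top UNIV)"
    by (rule infsum_tendsto[OF coord_square_summable])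
  then have "((\<lambda>F. sqrt (infsum ?q UNIV - sum ?q F)) \<longlongrightarrow> sqrt (infsum ?q UNIV - infsum ?q UNIV))
      (finite_subsets_at_top UNIV)"
    by (intro tendsto_intros)
  then have "((\<lambda>F. norm (?S F - x)) \<longlongrightarrow> 0) (finite_subsets_at_top UNIV)"
    by (subst tendsto_cong[where g = "\<lambda>F. sqrt (infsum ?q UNIV - sum ?q F)"])
       (rule eventually_finite_subsets_at_top_weakI, erule n, simp)
  then show ?thesis
    unfolding has_sum_def by (simp add: tendsto_norm_zero_iff LIM_zero_iff)
qed

section \<open>Bounded operators\<close>

text \<open>
  The library's type of bounded linear maps is real linear; a bounded operator is an element of
  it that is complex linear.
\<close>

definition bounded_ops :: "('a ell2 \<Rightarrow>\<^sub>L 'b ell2) set" where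
  "bounded_ops = {T. \<forall>c x. blinfun_apply T (scale_ell2 c x) = scale_ell2 c (blinfun_apply T x)}"

lemma bounded_linear_scale_ell2:
  "bounded_linear (scale_ell2 c :: 'b ell2 \<Rightarrow> 'b ell2)"
  by (rule bounded_linear_intro[where K = "cmod c"])
     (simp_all add: ell2.scale_right_distrib scaleR_ell2_def norm_scale_ell2 mult.commute)

definition scale_op :: "complex \<Rightarrow> ('a ell2 \<Rightarrow>\<^sub>L 'b ell2) \<Rightarrow> ('a ell2 \<Rightarrow>\<^sub>L 'b ell2)" where
  "scale_op c T = Blinfun (\<lambda>x. scale_ell2 c (blinfun_apply T x))"

lemma scale_op_apply: "blinfun_apply (scale_op c T) x = scale_ell2 c (blinfun_apply T x)"
  unfolding scale_op_def
  by (subst bounded_linear_Blinfun_apply)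
     (rule bounded_linear_compose[OF bounded_linear_scale_ell2 blinfun.bounded_linear_right], rule refl)

global_interpretation op: vector_space
  "scale_op :: complex \<Rightarrow> ('a ell2 \<Rightarrow>\<^sub>L 'b ell2) \<Rightarrow> ('a ell2 \<Rightarrow>\<^sub>L 'b ell2)"
  by unfold_locales
     (rule blinfun_eqI; simp add: scale_op_apply blinfun.add_left ell2.scale_right_distrib
       ell2.scale_left_distrib)+

lemma bounded_op_expansion:
  assumes "T \<in> bounded_ops"
  shows "((\<lambda>s. scale_ell2 (coord x s) (blinfun_apply T (ket s))) has_sum blinfun_apply T x) UNIV"
  using has_sum_bounded_linear[OF blinfun.bounded_linear_right ell2_expansion, of T x] assms
  by (simp add: bounded_ops_def o_def)

lemma bounded_op_eqI:
  assumes "T \<in> bounded_ops" "U \<in> bounded_ops"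
    and "\<And>s. blinfun_apply T (ket s) = blinfun_apply U (ket s)"
  shows "T = U"
proof (rule blinfun_eqI)
  fix x
  show "blinfun_apply T x = blinfun_apply U x"
    using bounded_op_expansion[OF assms(1), of x] bounded_op_expansion[OF assms(2), of x]
    by (simp add: assms(3) has_sum_unique)
qed

definition adj :: "('a ell2 \<Rightarrow>\<^sub>L 'b ell2) \<Rightarrow> ('b ell2 \<Rightarrow>\<^sub>L 'a ell2)" where
  "adj T = (THE U. U \<in> bounded_ops \<and>
     (\<forall>x y. cinner (blinfun_apply U y) x = cinner y (blinfun_apply T x)))"

lemma cinner_eqI:
  assumes "\<And>y. cinner x y = cinner x' y"
  shows "x = x'"
proof -
  have "coord x s = coord x' s" for s
    using assms[of "ket s"] by (metis cinner_commute cinner_ket_left)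
  then show ?thesis by (simp add: coord_inject[symmetric] fun_eq_iff)
qed

lemma adj_exists:
  fixes T :: "'a ell2 \<Rightarrow>\<^sub>L 'b ell2"
  assumes T: "T \<in> bounded_ops"
  shows "\<exists>U\<in>bounded_ops. \<forall>x y. cinner (blinfun_apply U y) x = cinner y (blinfun_apply T x)"
proof -
  define v where "v y s = cinner (blinfun_apply T (ket s)) y" for y s
  have fin: "(\<Sum>s\<in>F. (cmod (v y s))\<^sup>2) \<le> (norm T * norm y)\<^sup>2" if F: "finite F" for F y
  proof -
    define z where "z = (\<Sum>s\<in>F. scale_ell2 (v y s) (ket s))"
    define q where "q = (\<Sum>s\<in>F. (cmod (v y s))\<^sup>2)"
    have q0: "0 \<le> q" by (simp add: q_def sum_nonneg)
    have "(\<Sum>\<^sub>\<infinity>s. (cmod (coord z s))\<^sup>2) = (\<Sum>\<^sub>\<infinity>s\<in>F. (cmod (v y s))\<^sup>2)"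
      by (rule infsum_cong_neutral) (auto simp: z_def coord_finite_expansion[OF F])
    then have nz: "norm z = sqrt q" using F by (simp add: norm_ell2.rep_eq q_def)
    have "blinfun_apply T z = (\<Sum>s\<in>F. scale_ell2 (v y s) (blinfun_apply T (ket s)))"
      using T by (simp add: z_def blinfun.sum_right bounded_ops_def)
    then have "cinner (blinfun_apply T z) y = (\<Sum>s\<in>F. cnj (v y s) * v y s)"
      by (subst cinner_commute)
         (simp add: linear_sum[OF bounded_linear.linear[OF bounded_linear_cinner]] cinner_scale_right
           v_def cinner_commute[of y] mult.commute)
    also have "\<dots> = complex_of_real q"
      by (simp add: q_def complex_norm_square mult.commute del: of_real_power)
    finally have "q = cmod (cinner (blinfun_apply T z) y)" using q0 by simp
    also have "\<dots> \<le> norm (blinfun_apply T z) * norm y" by (rule cmod_cinner_le)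
    also have "\<dots> \<le> (norm T * norm z) * norm y"
      by (intro mult_right_mono norm_blinfun norm_ge_zero)
    finally have le: "sqrt q * sqrt q \<le> sqrt q * (norm T * norm y)"
      using q0 by (simp add: nz mult_ac)
    have "sqrt q \<le> norm T * norm y"
    proof (cases "q = 0")
      case False
      then have "0 < sqrt q" using q0 by simp
      with le show ?thesis by (rule mult_left_le_imp_le)
    qed simp
    then have "(sqrt q)\<^sup>2 \<le> (norm T * norm y)\<^sup>2" using q0 by (intro power_mono) auto
    then show ?thesis using q0 by (simp add: q_def)
  qed
  define U where "U y = Abs_ell2 (v y)" for y
  have cU: "coord (U y) = v y" for y
    unfolding U_def using norm_ell2_le(1)[OF fin] by (subst Abs_ell2_inverse) auto
  have Uadd: "U (y + z) = U y + U z" for y z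
    by (simp add: coord_inject[symmetric] plus_ell2.rep_eq cU v_def cinner_add_right fun_eq_iff)
  have Uscale: "U (scale_ell2 c y) = scale_ell2 c (U y)" for c y
    by (simp add: coord_inject[symmetric] scale_ell2.rep_eq cU v_def cinner_scale_right fun_eq_iff)
  have "norm (U y) \<le> norm T * norm y" for y
    unfolding U_def by (rule norm_ell2_le(2)[OF fin]) auto
  then have bl: "bounded_linear U"
    by (intro bounded_linear_intro[where K = "norm T"])
       (simp_all add: Uadd scaleR_ell2_def Uscale mult.commute)
  have "cinner (U y) x = cinner y (blinfun_apply T x)" for x y
  proof -
    have "((\<lambda>s. cinner (U y) (scale_ell2 (coord x s) (ket s))) has_sum cinner (U y) x) UNIV"
      by (rule has_sum_bounded_linear[OF bounded_linear_cinner ell2_expansion, unfolded o_def])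
    moreover have "((\<lambda>s. cinner y (scale_ell2 (coord x s) (blinfun_apply T (ket s))))
        has_sum cinner y (blinfun_apply T x)) UNIV"
      by (rule has_sum_bounded_linear[OF bounded_linear_cinner bounded_op_expansion[OF T],
            unfolded o_def])
    moreover have "cinner (U y) (ket s) = cinner y (blinfun_apply T (ket s))" for s
      by (subst cinner_commute) (simp add: cinner_ket_left cU v_def cinner_commute[of y])
    ultimately show ?thesis by (simp add: cinner_scale_right has_sum_unique)
  qed
  then show ?thesis
    by (intro bexI[of _ "Blinfun U"])
       (auto simp: bounded_ops_def bounded_linear_Blinfun_apply[OF bl] Uscale)
qed

lemma adj_unique:
  assumes "\<forall>x y. cinner (blinfun_apply U y) x = cinner y (blinfun_apply T x)"
    and "\<forall>x y. cinner (blinfun_apply U' y) x = cinner y (blinfun_apply T x)"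
  shows "U = U'"
  by (rule blinfun_eqI, rule cinner_eqI) (simp add: assms)

lemma adj_props:
  assumes "T \<in> bounded_ops"
  shows adj_bounded_ops: "adj T \<in> bounded_ops"
    and cinner_adj: "cinner (blinfun_apply (adj T) y) x = cinner y (blinfun_apply T x)"
proof -
  have "adj T \<in> bounded_ops \<and>
      (\<forall>x y. cinner (blinfun_apply (adj T) y) x = cinner y (blinfun_apply T x))"
    unfolding adj_def
    by (rule theI') (use adj_exists[OF assms] in \<open>blast intro: adj_unique\<close>)
  then show "adj T \<in> bounded_ops"
    "cinner (blinfun_apply (adj T) y) x = cinner y (blinfun_apply T x)" by auto
qed

text \<open>The bounded operator with prescribed values on the canonical basis, if there is one.\<close>

definition op_on_basis :: "('a \<Rightarrow> 'b ell2) \<Rightarrow> ('a ell2 \<Rightarrow>\<^sub>L 'b ell2)" where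
  "op_on_basis g = (THE T. T \<in> bounded_ops \<and> (\<forall>s. blinfun_apply T (ket s) = g s))"

lemma op_on_basis_eqI:
  assumes "T \<in> bounded_ops" "\<And>s. blinfun_apply T (ket s) = g s"
  shows "op_on_basis g = T"
  unfolding op_on_basis_def by (rule the_equality) (use assms in \<open>auto intro: bounded_op_eqI\<close>)

lemma op_on_basis_partial_inj:
  fixes f :: "'a \<rightharpoonup> 'b"
  assumes inj: "inj_on f (dom f)"
    and g: "\<And>s. g s = (case f s of None \<Rightarrow> 0 | Some t \<Rightarrow> ket t)"
  shows "op_on_basis g \<in> bounded_ops" "blinfun_apply (op_on_basis g) (ket s) = g s"
proof -
  define W where "W x t = (if t \<in> ran f then x (THE s. f s = Some t) else 0)"
    for x :: "'a \<Rightarrow> complex" and t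
  have the: "(THE s'. f s' = Some t) = s" if "f s = Some t" for s t
    using that inj by (intro the_equality) (auto simp: inj_on_def dom_def)
  have fin: "(\<Sum>t\<in>F. (cmod (W (coord x) t))\<^sup>2) \<le> (norm x)\<^sup>2" if F: "finite F" for x F
  proof -
    let ?i = "\<lambda>t. THE s. f s = Some t"
    have inj': "inj_on ?i (F \<inter> ran f)"
      by (rule inj_onI) (use the in \<open>force simp: ran_def\<close>)
    have "(\<Sum>t\<in>F. (cmod (W (coord x) t))\<^sup>2) = (\<Sum>t\<in>F \<inter> ran f. (cmod (coord x (?i t)))\<^sup>2)"
      by (rule sum.mono_neutral_cong_right) (use F in \<open>auto simp: W_def\<close>)
    also have "\<dots> = (\<Sum>s\<in>?i ` (F \<inter> ran f). (cmod (coord x s))\<^sup>2)"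
      by (simp add: sum.reindex[OF inj'])
    also have "\<dots> \<le> (\<Sum>\<^sub>\<infinity>s. (cmod (coord x s))\<^sup>2)"
      by (rule finite_sum_le_infsum[OF coord_square_summable]) (use F in auto)
    also have "\<dots> = (norm x)\<^sup>2" by (simp add: norm_ell2.rep_eq infsum_nonneg)
    finally show ?thesis .
  qed
  define V where "V x = Abs_ell2 (W (coord x))" for x
  have cV: "coord (V x) = W (coord x)" for x
    unfolding V_def using norm_ell2_le(1)[OF fin] by (subst Abs_ell2_inverse) auto
  have add: "V (x + y) = V x + V y" for x y
    by (simp add: coord_inject[symmetric] plus_ell2.rep_eq cV W_def fun_eq_iff)
  have scale: "V (scale_ell2 c x) = scale_ell2 c (V x)" for c x
    by (simp add: coord_inject[symmetric] scale_ell2.rep_eq cV W_def fun_eq_iff)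
  have "norm (V x) \<le> norm x" for x
    unfolding V_def by (rule norm_ell2_le(2)[OF fin]) auto
  then have bl: "bounded_linear V"
    by (intro bounded_linear_intro[where K = 1]) (simp_all add: add scaleR_ell2_def scale)
  have ket: "V (ket s) = g s" for s
  proof -
    have "W (coord (ket s)) t = coord (g s) t" for t
    proof (cases "t \<in> ran f")
      case True
      then obtain s' where s': "f s' = Some t" by (auto simp: ran_def)
      then show ?thesis
        using True inj the[OF s'] unfolding g W_def
        by (auto simp: ket.rep_eq zero_ell2.rep_eq inj_on_def dom_def split: option.split)
    next
      case False
      then show ?thesis unfolding g W_def
        by (auto simp: ket.rep_eq zero_ell2.rep_eq ran_def split: option.split)
    qed
    then show ?thesis by (simp add: coord_inject[symmetric] cV fun_eq_iff)
  qed
  have *: "Blinfun V \<in> bounded_ops" "blinfun_apply (Blinfun V) (ket s) = g s" for s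
    by (auto simp: bounded_ops_def bounded_linear_Blinfun_apply[OF bl] scale ket)
  have "op_on_basis g = Blinfun V" by (rule op_on_basis_eqI) (fact *)+
  then show "op_on_basis g \<in> bounded_ops" "blinfun_apply (op_on_basis g) (ket s) = g s"
    using * by simp_all
qed

section \<open>*-algebras\<close>

record 'x star_algebra =
  elems :: "'x set"
  add :: "'x \<Rightarrow> 'x \<Rightarrow> 'x"
  scale :: "complex \<Rightarrow> 'x \<Rightarrow> 'x"
  mult :: "'x \<Rightarrow> 'x \<Rightarrow> 'x"
  invol :: "'x \<Rightarrow> 'x"

definition op_algebra :: "('a ell2 \<Rightarrow>\<^sub>L 'a ell2) set \<Rightarrow> ('a ell2 \<Rightarrow>\<^sub>L 'a ell2) star_algebra" where
  "op_algebra A = \<lparr>elems = A, add = (+), scale = scale_op, mult = (o\<^sub>L), invol = adj\<rparr>"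

definition coset :: "'x star_algebra \<Rightarrow> 'x set \<Rightarrow> 'x \<Rightarrow> 'x set" where
  "coset A N x = (\<lambda>n. add A x n) ` N"

definition quotient_algebra :: "'x star_algebra \<Rightarrow> 'x set \<Rightarrow> 'x set star_algebra" where
  "quotient_algebra A N =
     \<lparr>elems = coset A N ` elems A,
      add = (\<lambda>X Y. \<Union>x\<in>X. \<Union>y\<in>Y. coset A N (add A x y)),
      scale = (\<lambda>c X. \<Union>x\<in>X. coset A N (scale A c x)),
      mult = (\<lambda>X Y. \<Union>x\<in>X. \<Union>y\<in>Y. coset A N (mult A x y)),
      invol = (\<lambda>X. \<Union>x\<in>X. coset A N (invol A x))\<rparr>"

definition star_hom :: "'x star_algebra \<Rightarrow> 'y star_algebra \<Rightarrow> ('x \<Rightarrow> 'y) \<Rightarrow> bool" where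
  "star_hom A B h \<longleftrightarrow>
     h ` elems A \<subseteq> elems B \<and>
     (\<forall>x\<in>elems A. \<forall>y\<in>elems A. h (add A x y) = add B (h x) (h y)) \<and>
     (\<forall>c. \<forall>x\<in>elems A. h (scale A c x) = scale B c (h x)) \<and>
     (\<forall>x\<in>elems A. \<forall>y\<in>elems A. h (mult A x y) = mult B (h x) (h y)) \<and>
     (\<forall>x\<in>elems A. h (invol A x) = invol B (h x))"

definition surjective_star_hom :: "'x star_algebra \<Rightarrow> 'y star_algebra \<Rightarrow> ('x \<Rightarrow> 'y) \<Rightarrow> bool" where
  "surjective_star_hom A B h \<longleftrightarrow> star_hom A B h \<and> h ` elems A = elems B"

definition concrete_cstar_algebra :: "('a ell2 \<Rightarrow>\<^sub>L 'a ell2) set \<Rightarrow> bool" where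
  "concrete_cstar_algebra A \<longleftrightarrow>
     A \<subseteq> bounded_ops \<and> op.subspace A \<and> closed A \<and>
     (\<forall>T\<in>A. \<forall>U\<in>A. T o\<^sub>L U \<in> A) \<and> (\<forall>T\<in>A. adj T \<in> A)"

definition cstar_generated :: "('a ell2 \<Rightarrow>\<^sub>L 'a ell2) set \<Rightarrow> ('a ell2 \<Rightarrow>\<^sub>L 'a ell2) set" where
  "cstar_generated X = \<Inter> {A. concrete_cstar_algebra A \<and> X \<subseteq> A}"

lemma concrete_cstar_algebra_bounded_ops:
  "concrete_cstar_algebra (bounded_ops :: ('a ell2 \<Rightarrow>\<^sub>L 'a ell2) set)"
proof -
  have "closed (bounded_ops :: ('a ell2 \<Rightarrow>\<^sub>L 'a ell2) set)"
  proof -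
    have "closed {T :: 'a ell2 \<Rightarrow>\<^sub>L 'a ell2.
        blinfun_apply T (scale_ell2 c x) = blinfun_apply (scale_op c id_blinfun o\<^sub>L T) x}" for c x
      by (intro closed_Collect_eq continuous_intros)
    then have "closed (\<Inter>c. \<Inter>x. {T :: 'a ell2 \<Rightarrow>\<^sub>L 'a ell2.
        blinfun_apply T (scale_ell2 c x) = blinfun_apply (scale_op c id_blinfun o\<^sub>L T) x})"
      by (intro closed_INT ballI)
    moreover have "bounded_ops = (\<Inter>c. \<Inter>x. {T :: 'a ell2 \<Rightarrow>\<^sub>L 'a ell2.
        blinfun_apply T (scale_ell2 c x) = blinfun_apply (scale_op c id_blinfun o\<^sub>L T) x})"
      by (auto simp: bounded_ops_def scale_op_apply)
    ultimately show ?thesis by simp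
  qed
  then show ?thesis
    unfolding concrete_cstar_algebra_def op.subspace_def
    by (auto simp: adj_bounded_ops)
       (auto simp: bounded_ops_def blinfun.add_left scale_op_apply ell2.scale_right_distrib
         mult.commute)
qed

section \<open>Inverse semigroups\<close>

class star =
  fixes star :: "'a \<Rightarrow> 'a"  ("_\<^sup>\<star>" [1000] 999)

class inverse_semigroup = semigroup_mult + star +
  assumes star_iff: "x * y * x = x \<and> y * x * y = y \<longleftrightarrow> y = x\<^sup>\<star>"

definition left_regular :: "'p::inverse_semigroup \<Rightarrow> ('p ell2 \<Rightarrow>\<^sub>L 'p ell2)" where
  "left_regular p = op_on_basis (\<lambda>q. if p\<^sup>\<star> * p * q = q then ket (p * q) else 0)"

lemma left_regular:
  "left_regular p \<in> bounded_ops"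
  "blinfun_apply (left_regular p) (ket q) = (if p\<^sup>\<star> * p * q = q then ket (p * q) else 0)"
proof -
  let ?f = "\<lambda>q. if p\<^sup>\<star> * p * q = q then Some (p * q) else None"
  have "inj_on ?f (dom ?f)"
    unfolding inj_on_def dom_def by (auto split: if_splits) (metis mult.assoc)
  note * = op_on_basis_partial_inj[OF this,
      of "\<lambda>q. if p\<^sup>\<star> * p * q = q then ket (p * q) else 0", folded left_regular_def]
  show "left_regular p \<in> bounded_ops" by (rule *) auto
  show "blinfun_apply (left_regular p) (ket q) = (if p\<^sup>\<star> * p * q = q then ket (p * q) else 0)"
    by (rule *) auto
qed

definition reduced_cstar :: "('p::inverse_semigroup ell2 \<Rightarrow>\<^sub>L 'p ell2) set" where
  "reduced_cstar = closure (op.span (range left_regular))"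

section \<open>Partial bijections and the left inverse hull\<close>

typedef 'a partial_bij = "{f :: 'a \<rightharpoonup> 'a. inj_on f (dom f)}"
  morphisms pfun Abs_partial_bij
  by (rule exI[of _ Map.empty]) simp

setup_lifting type_definition_partial_bij

lemma pfun_inj: "pfun f s = Some t \<Longrightarrow> pfun f s' = Some t \<Longrightarrow> s = s'"
  using pfun[of f] by (auto simp: inj_on_def dom_def)

lemma partial_inj_iff:
  "inj_on f (dom f) \<longleftrightarrow> (\<forall>s s' t. f s = Some t \<longrightarrow> f s' = Some t \<longrightarrow> s = s')"
  by (auto simp: inj_on_def dom_def)

definition inverse_map :: "('a \<rightharpoonup> 'b) \<Rightarrow> ('b \<rightharpoonup> 'a)" where
  "inverse_map f t = (if \<exists>s. f s = Some t then Some (THE s. f s = Some t) else None)"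

lemma inverse_map_iff:
  assumes "inj_on f (dom f)"
  shows "inverse_map f t = Some s \<longleftrightarrow> f s = Some t"
proof -
  have "(THE s'. f s' = Some t) = s'" if "f s' = Some t" for s'
    using that assms unfolding partial_inj_iff by blast
  then show ?thesis by (auto simp: inverse_map_def)
qed

instantiation partial_bij :: (type) inverse_semigroup
begin

lift_definition times_partial_bij :: "'a partial_bij \<Rightarrow> 'a partial_bij \<Rightarrow> 'a partial_bij" is
  "\<lambda>f g. f \<circ>\<^sub>m g"
  unfolding partial_inj_iff by (auto simp: map_comp_Some_iff)

lift_definition star_partial_bij :: "'a partial_bij \<Rightarrow> 'a partial_bij" is inverse_map
  by (subst partial_inj_iff) (auto simp: inverse_map_iff)

instance
proof
  fix f g h :: "'a partial_bij"
  show "f * g * h = f * (g * h)"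
    by transfer (auto simp: map_comp_def fun_eq_iff split: option.splits)
  show "f * g * f = f \<and> g * f * g = g \<longleftrightarrow> g = f\<^sup>\<star>"
  proof (transfer, safe)
    fix f g :: "'a \<rightharpoonup> 'a"
    assume i: "inj_on f (dom f)" "inj_on g (dom g)"
    {
      assume fg: "f \<circ>\<^sub>m g \<circ>\<^sub>m f = f" and gf: "g \<circ>\<^sub>m f \<circ>\<^sub>m g = g"
      have "g t = Some s \<longleftrightarrow> inverse_map f t = Some s" for s t
        unfolding inverse_map_iff[OF i(1)]
      proof
        assume "g t = Some s"
        moreover from this have "(g \<circ>\<^sub>m f \<circ>\<^sub>m g) t = Some s" using gf by simp
        ultimately obtain r where "f s = Some r" "g r = Some s"
          by (auto simp: map_comp_Some_iff)
        then show "f s = Some t" using \<open>g t = Some s\<close> i(2) by (metis partial_inj_iff)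
      next
        assume "f s = Some t"
        moreover from this have "(f \<circ>\<^sub>m g \<circ>\<^sub>m f) s = Some t" using fg by simp
        ultimately obtain r where "g t = Some r" "f r = Some t"
          by (auto simp: map_comp_Some_iff)
        then show "g t = Some s" using \<open>f s = Some t\<close> i(1) by (metis partial_inj_iff)
      qed
      then show "g = inverse_map f"
        by (intro ext) (metis not_None_eq)
    }
    have "(f \<circ>\<^sub>m inverse_map f \<circ>\<^sub>m f) s = f s" for s
      using inverse_map_iff[OF i(1), THEN iffD2] by (cases "f s") (auto simp: map_comp_def)
    then show "f \<circ>\<^sub>m inverse_map f \<circ>\<^sub>m f = f" by auto
    have "(inverse_map f \<circ>\<^sub>m f \<circ>\<^sub>m inverse_map f) s = inverse_map f s" for s
      using inverse_map_iff[OF i(1), THEN iffD1]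
      by (cases "inverse_map f s") (auto simp: map_comp_def)
    then show "inverse_map f \<circ>\<^sub>m f \<circ>\<^sub>m inverse_map f = inverse_map f" by auto
  qed
qed

end

instantiation partial_bij :: (type) zero
begin
lift_definition zero_partial_bij :: "'a partial_bij" is Map.empty by simp
instance ..
end

class left_cancel_monoid = monoid_mult +
  assumes left_cancel: "s * r = s * t \<Longrightarrow> r = t"

lift_definition left_translation :: "'s::left_cancel_monoid \<Rightarrow> 's partial_bij" is
  "\<lambda>s t. Some (s * t)"
  by (auto intro: inj_onI left_cancel)

inductive_set left_hull_set :: "'s::left_cancel_monoid partial_bij set" where
  translation: "left_translation s \<in> left_hull_set"
| mult: "f \<in> left_hull_set \<Longrightarrow> g \<in> left_hull_set \<Longrightarrow> f * g \<in> left_hull_set"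
| star: "f \<in> left_hull_set \<Longrightarrow> f\<^sup>\<star> \<in> left_hull_set"

typedef (overloaded) 's left_hull = "left_hull_set :: 's::left_cancel_monoid partial_bij set"
  morphisms pbij Abs_left_hull
  using left_hull_set.translation by blast

setup_lifting type_definition_left_hull

instantiation left_hull :: (left_cancel_monoid) inverse_semigroup
begin
lift_definition times_left_hull :: "'a left_hull \<Rightarrow> 'a left_hull \<Rightarrow> 'a left_hull" is "(*)"
  by (rule left_hull_set.mult)
lift_definition star_left_hull :: "'a left_hull \<Rightarrow> 'a left_hull" is star
  by (rule left_hull_set.star)
instance
  by standard (transfer, simp add: mult.assoc, transfer, rule star_iff)
end

section \<open>The two C*-algebras\<close>

definition translation_op :: "'s::left_cancel_monoid \<Rightarrow> ('s ell2 \<Rightarrow>\<^sub>L 's ell2)" where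
  "translation_op s = op_on_basis (\<lambda>t. ket (s * t))"

lemma translation_op:
  "translation_op s \<in> bounded_ops" "blinfun_apply (translation_op s) (ket t) = ket (s * t)"
proof -
  have inj: "inj_on (\<lambda>t. Some (s * t)) (dom (\<lambda>t. Some (s * t)))"
    by (auto intro: inj_onI left_cancel)
  show "translation_op s \<in> bounded_ops" "blinfun_apply (translation_op s) (ket t) = ket (s * t)"
    unfolding translation_op_def by (rule op_on_basis_partial_inj[OF inj]; simp)+
qed

definition semigroup_cstar :: "('s::left_cancel_monoid ell2 \<Rightarrow>\<^sub>L 's ell2) star_algebra" where
  "semigroup_cstar = op_algebra (cstar_generated (range translation_op))"

definition omega :: "'s::left_cancel_monoid left_hull \<Rightarrow> ('s ell2 \<Rightarrow>\<^sub>L 's ell2)" where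
  "omega f = op_on_basis (\<lambda>s. case pfun (pbij f) s of Some t \<Rightarrow> ket t | None \<Rightarrow> 0)"

lemma omega:
  "omega f \<in> bounded_ops"
  "blinfun_apply (omega f) (ket s) = (case pfun (pbij f) s of Some t \<Rightarrow> ket t | None \<Rightarrow> 0)"
proof -
  have inj: "inj_on (pfun (pbij f)) (dom (pfun (pbij f)))" using pfun[of "pbij f"] by simp
  show "omega f \<in> bounded_ops"
    "blinfun_apply (omega f) (ket s) = (case pfun (pbij f) s of Some t \<Rightarrow> ket t | None \<Rightarrow> 0)"
    unfolding omega_def by (rule op_on_basis_partial_inj[OF inj]; simp)+
qed

text \<open>
  If the empty map is not in the left inverse hull, the algebra is divided by the zero ideal,
  so that its elements are the singletons \<open>{T}\<close>.
\<close>

definition empty_map_ideal ::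
  "('s::left_cancel_monoid left_hull ell2 \<Rightarrow>\<^sub>L 's left_hull ell2) set" where
  "empty_map_ideal =
     (if (0 :: 's partial_bij) \<in> left_hull_set
      then {scale_op c (left_regular (Abs_left_hull 0)) | c. True} else {0})"

definition hull_cstar0 ::
  "('s::left_cancel_monoid left_hull ell2 \<Rightarrow>\<^sub>L 's left_hull ell2) set star_algebra" where
  "hull_cstar0 = quotient_algebra (op_algebra reduced_cstar) empty_map_ideal"

definition left_regular0 ::
  "'s::left_cancel_monoid left_hull \<Rightarrow> ('s left_hull ell2 \<Rightarrow>\<^sub>L 's left_hull ell2) set" where
  "left_regular0 f = coset (op_algebra reduced_cstar) empty_map_ideal (left_regular f)"

end

theory Submission
  imports Defs
begin

text \<open>
  Let \<open>U\<close> be the isometry from \<open>l\<^sup>2(S)\<close> to \<open>l\<^sup>2(I\<^sub>l(S))\<close> sending the basis vector of \<open>s\<close> to that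
  of \<open>\<lambda>\<^sub>s\<close>. Elements of \<open>I\<^sub>l(S)\<close> commute with right translations, so \<open>s \<in> dom f\<close> holds exactly when
  \<open>f* f \<lambda>\<^sub>s = \<lambda>\<^sub>s\<close>, and then \<open>f \<lambda>\<^sub>s = \<lambda>\<^bsub>f(s)\<^esub>\<close>. Hence \<open>\<Lambda>(f) U = U \<omega>(f)\<close>: the range of \<open>U\<close>
  is invariant, and the homomorphism is the compression \<open>T \<mapsto> U* T U\<close>, which kills \<open>\<Lambda>(0)\<close>.
  Surjectivity needs the image to be closed. Instead of functional calculus, elements of the image
  are lifted approximately, with control of the norm, using \<open>a (1 + a* a)\<^sup>-\<^sup>1\<close>.
\<close>

section \<open>Completeness\<close>

lemma norm_coord_le: "cmod (coord x s) \<le> norm x"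
proof -
  have "cmod (coord x s) \<le> norm (ket s) * norm x"
    using cmod_cinner_le[of "ket s" x] by (simp add: cinner_ket_left)
  moreover have "norm (ket s) = 1"
  proof -
    have "complex_of_real ((norm (ket s))\<^sup>2) = 1"
      unfolding cinner_self_norm[symmetric] cinner_ket_left by (simp add: ket.rep_eq)
    then have "(norm (ket s))\<^sup>2 = 1" by (simp only: of_real_eq_1_iff)
    then have "norm (ket s) = 1 \<or> norm (ket s) = - 1" by (simp only: power2_eq_1_iff)
    then show ?thesis using norm_ge_zero[of "ket s"] by linarith
  qed
  ultimately show ?thesis by simp
qed

text \<open>Completeness of \<open>'a ell2\<close> makes the operator space complete, as needed both
  for the Banach fixed point argument and for summing a series of lifts.\<close>

instance ell2 :: (type) banach
proof
  fix X :: "nat \<Rightarrow> 'a ell2"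
  assume C: "Cauchy X"
  have "Cauchy (\<lambda>n. coord (X n) s)" for s
  proof (rule metric_CauchyI)
    fix e :: real assume "0 < e"
    with C obtain N where "\<forall>m\<ge>N. \<forall>n\<ge>N. dist (X m) (X n) < e" by (auto simp: Cauchy_def)
    then show "\<exists>N. \<forall>m\<ge>N. \<forall>n\<ge>N. dist (coord (X m) s) (coord (X n) s) < e"
      by (intro exI[of _ N])
         (auto simp: dist_norm simp flip: coord_diff intro: order_le_less_trans[OF norm_coord_le])
  qed
  then have "\<exists>l. (\<lambda>n. coord (X n) s) \<longlonglongrightarrow> l" for s
    by (simp add: Cauchy_convergent_iff convergent_def)
  then obtain l where l: "\<And>s. (\<lambda>n. coord (X n) s) \<longlonglongrightarrow> l s" by metis
  \<comment> \<open>A Cauchy estimate restricted to a finite \<open>F\<close> survives the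
    coordinatewise limit. Being uniform in \<open>F\<close>, it yields both square summability of
    \<open>l\<close> and convergence in norm.\<close>
  have tail: "(\<Sum>s\<in>F. (cmod (l s - coord (X m) s))\<^sup>2) \<le> e\<^sup>2"
    if N: "\<forall>m\<ge>N. \<forall>n\<ge>N. dist (X m) (X n) < e" and m: "N \<le> m" and F: "finite F" for e N m F
  proof (rule tendsto_upperbound)
    show "(\<lambda>n. \<Sum>s\<in>F. (cmod (coord (X n) s - coord (X m) s))\<^sup>2)
        \<longlonglongrightarrow> (\<Sum>s\<in>F. (cmod (l s - coord (X m) s))\<^sup>2)"
      by (intro tendsto_intros l)
    show "\<forall>\<^sub>F n in sequentially. (\<Sum>s\<in>F. (cmod (coord (X n) s - coord (X m) s))\<^sup>2) \<le> e\<^sup>2"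
      unfolding eventually_sequentially
    proof (intro exI allI impI)
      fix n assume n: "N \<le> n"
      have "(\<Sum>s\<in>F. (cmod (coord (X n - X m) s))\<^sup>2) \<le> (\<Sum>\<^sub>\<infinity>s. (cmod (coord (X n - X m) s))\<^sup>2)"
        by (rule finite_sum_le_infsum[OF coord_square_summable]) (use F in auto)
      also have "\<dots> = (norm (X n - X m))\<^sup>2" by (simp add: norm_ell2.rep_eq infsum_nonneg)
      also have "\<dots> \<le> e\<^sup>2"
        using N m n by (intro power_mono) (auto simp: dist_norm less_imp_le)
      finally show "(\<Sum>s\<in>F. (cmod (coord (X n) s - coord (X m) s))\<^sup>2) \<le> e\<^sup>2"
        by (simp add: coord_diff)
    qed
  qed simp
  obtain N1 where N1: "\<forall>m\<ge>N1. \<forall>n\<ge>N1. dist (X m) (X n) < 1"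
    using C unfolding Cauchy_def by (metis zero_less_one)
  have "(\<lambda>s. (cmod (l s - coord (X N1) s))\<^sup>2) summable_on UNIV"
    by (rule norm_ell2_le(1)[where B = 1]) (use tail[OF N1 order_refl] in auto)
  from square_summable_add[OF this coord_square_summable[of "X N1"]]
  have sl: "(\<lambda>s. (cmod (l s))\<^sup>2) summable_on UNIV" by simp
  have cl: "coord (Abs_ell2 l) = l" using sl by (simp add: Abs_ell2_inverse)
  have "X \<longlonglongrightarrow> Abs_ell2 l"
  proof (rule metric_LIMSEQ_I)
    fix e :: real assume e: "0 < e"
    then obtain N where N: "\<forall>m\<ge>N. \<forall>n\<ge>N. dist (X m) (X n) < e / 2"
      using C unfolding Cauchy_def by (metis half_gt_zero)
    have "dist (X m) (Abs_ell2 l) < e" if m: "N \<le> m" for m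
    proof -
      have "Abs_ell2 (\<lambda>s. l s - coord (X m) s) = Abs_ell2 l - X m"
        by (metis (no_types, lifting) coord_inverse coord_diff cl ext)
      moreover have "norm (Abs_ell2 (\<lambda>s. l s - coord (X m) s)) \<le> e / 2"
        by (rule norm_ell2_le(2)) (use tail[OF N m] e in auto)
      ultimately show ?thesis using e by (simp add: dist_norm norm_minus_commute)
    qed
    then show "\<exists>N. \<forall>n\<ge>N. dist (X n) (Abs_ell2 l) < e" by blast
  qed
  then show "convergent X" by (auto simp: convergent_def)
qed

section \<open>Adjoints\<close>

lemma bounded_ops_scale:
  "T \<in> bounded_ops \<Longrightarrow> blinfun_apply T (scale_ell2 c x) = scale_ell2 c (blinfun_apply T x)"
  by (simp add: bounded_ops_def)

lemma bounded_ops_comp: "T \<in> bounded_ops \<Longrightarrow> U \<in> bounded_ops \<Longrightarrow> T o\<^sub>L U \<in> bounded_ops"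
  by (simp add: bounded_ops_def)

lemma bounded_ops_id: "id_blinfun \<in> bounded_ops"
  by (simp add: bounded_ops_def)

lemma subspace_bounded_ops: "op.subspace bounded_ops"
  unfolding op.subspace_def
  by (auto simp: bounded_ops_def blinfun.add_left scale_op_apply ell2.scale_right_distrib mult.commute)

lemma scale_op_of_real: "scale_op (complex_of_real r) T = r *\<^sub>R T"
  by (rule blinfun_eqI) (simp add: scale_op_apply blinfun.scaleR_left scaleR_ell2_def)

lemma norm_scale_op: "norm (scale_op c T) \<le> cmod c * norm T"
  by (rule norm_blinfun_bound)
     (auto simp: scale_op_apply norm_scale_ell2 mult.assoc intro!: mult_left_mono norm_blinfun)

lemma scale_op_compose:
  "scale_op c T o\<^sub>L U = scale_op c (T o\<^sub>L U)"
  "T \<in> bounded_ops \<Longrightarrow> T o\<^sub>L scale_op c U = scale_op c (T o\<^sub>L U)"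
  by (rule blinfun_eqI, simp add: scale_op_apply bounded_ops_scale)+

lemma blinfun_comp_assoc: "(T o\<^sub>L U) o\<^sub>L V = T o\<^sub>L (U o\<^sub>L V)"
  by (rule blinfun_eqI) simp

lemma adj_eqI:
  assumes "T \<in> bounded_ops" "\<And>x y. cinner (blinfun_apply U y) x = cinner y (blinfun_apply T x)"
  shows "adj T = U"
  by (rule adj_unique) (use assms cinner_adj[OF assms(1)] in auto)

lemma cinner_adj_right:
  assumes "T \<in> bounded_ops"
  shows "cinner x (blinfun_apply (adj T) y) = cinner (blinfun_apply T x) y"
  by (metis assms cinner_adj cinner_commute)

lemma adj_adj: "T \<in> bounded_ops \<Longrightarrow> adj (adj T) = T"
  by (rule adj_eqI) (simp_all add: adj_bounded_ops cinner_adj_right)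

lemma adj_comp:
  "T \<in> bounded_ops \<Longrightarrow> U \<in> bounded_ops \<Longrightarrow> adj (T o\<^sub>L U) = adj U o\<^sub>L adj T"
  by (rule adj_eqI) (simp_all add: bounded_ops_comp cinner_adj)

lemma adj_add:
  "T \<in> bounded_ops \<Longrightarrow> U \<in> bounded_ops \<Longrightarrow> adj (T + U) = adj T + adj U"
  by (rule adj_eqI)
     (simp_all add: op.subspace_add[OF subspace_bounded_ops] blinfun.add_left cinner_adj
       cinner_add_left cinner_add_right)

lemma adj_scale: "T \<in> bounded_ops \<Longrightarrow> adj (scale_op c T) = scale_op (cnj c) (adj T)"
  by (rule adj_eqI)
     (simp_all add: op.subspace_scale[OF subspace_bounded_ops] scale_op_apply cinner_adj
       cinner_scale_left cinner_scale_right)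

lemma adj_zero: "adj 0 = 0"
  using adj_scale[OF op.subspace_0[OF subspace_bounded_ops], of 0] by simp

lemma adj_diff:
  assumes "T \<in> bounded_ops" "U \<in> bounded_ops"
  shows "adj (T - U) = adj T - adj U"
  using adj_add[OF op.subspace_diff[OF subspace_bounded_ops assms] assms(2)]
  by (simp add: algebra_simps)

text \<open>With z = T* y, the square of norm z equals <y, T z>, which Cauchy-Schwarz bounds by norm
  y times norm T times norm z; one factor norm z cancels.\<close>

lemma norm_adj_le:
  assumes T: "T \<in> bounded_ops"
  shows "norm (adj T) \<le> norm T"
proof (rule norm_blinfun_bound)
  fix y
  let ?z = "blinfun_apply (adj T) y"
  have "cinner ?z ?z = cinner y (blinfun_apply T ?z)" by (rule cinner_adj[OF T])
  then have "(norm ?z)\<^sup>2 = cmod (cinner y (blinfun_apply T ?z))"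
    by (metis cinner_self_norm norm_of_real abs_power2)
  also have "\<dots> \<le> norm y * norm (blinfun_apply T ?z)" by (rule cmod_cinner_le)
  also have "\<dots> \<le> norm y * (norm T * norm ?z)"
    by (intro mult_left_mono norm_blinfun norm_ge_zero)
  finally have "norm ?z * norm ?z \<le> (norm T * norm y) * norm ?z"
    by (simp add: power2_eq_square mult_ac)
  then show "norm ?z \<le> norm T * norm y"
    by (cases "?z = 0") simp_all
qed simp

lemma adj_eq_on_basis:
  assumes T: "T \<in> bounded_ops" and U: "U \<in> bounded_ops"
    and eq: "\<And>s t. coord (blinfun_apply U (ket t)) s = cnj (coord (blinfun_apply T (ket s)) t)"
  shows "adj T = U"
proof (rule bounded_op_eqI[OF adj_bounded_ops[OF T] U])
  fix t
  have "coord (blinfun_apply (adj T) (ket t)) s = coord (blinfun_apply U (ket t)) s" for s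
    using cinner_adj_right[OF T, of "ket s" "ket t"] cinner_commute[of _ "ket t"]
    by (simp add: cinner_ket_left eq)
  then show "blinfun_apply (adj T) (ket t) = blinfun_apply U (ket t)"
    by (simp add: coord_inject[symmetric] fun_eq_iff)
qed

section \<open>Closures of *-subalgebras\<close>

text \<open>All operations are norm continuous. The binary ones are extended to the closure one
  argument at a time.\<close>

lemma concrete_cstar_algebra_closure:
  fixes M :: "('a ell2 \<Rightarrow>\<^sub>L 'a ell2) set"
  assumes M: "M \<subseteq> bounded_ops" "op.subspace M"
    and comp: "\<And>T U. T \<in> M \<Longrightarrow> U \<in> M \<Longrightarrow> T o\<^sub>L U \<in> M"
    and adj: "\<And>T. T \<in> M \<Longrightarrow> adj T \<in> M"
  shows "concrete_cstar_algebra (closure M)"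
proof -
  have cl: "closure M \<subseteq> bounded_ops"
    using concrete_cstar_algebra_bounded_ops M(1)
    by (intro closure_minimal) (auto simp: concrete_cstar_algebra_def)
  have step: "f T \<in> closure M"
    if "\<And>T. T \<in> M \<Longrightarrow> f T \<in> closure M" "continuous_on (closure M) f" "T \<in> closure M" for f T
    using image_closure_subset[OF that(2), of "closure M"] that(1,3) by auto
  have add1: "T + U \<in> closure M" if "T \<in> M" "U \<in> closure M" for T U
    by (rule step[of "\<lambda>U. T + U"])
       (use that op.subspace_add[OF M(2)] closure_subset in \<open>auto intro!: continuous_intros\<close>)
  have add: "T + U \<in> closure M" if "T \<in> closure M" "U \<in> closure M" for T U
    by (rule step[of "\<lambda>T. T + U"]) (use that add1 in \<open>auto intro!: continuous_intros\<close>)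
  have comp1: "T o\<^sub>L U \<in> closure M" if "T \<in> M" "U \<in> closure M" for T U
    by (rule step[of "\<lambda>U. T o\<^sub>L U"])
       (use that comp closure_subset in \<open>auto intro!: continuous_intros\<close>)
  have comp': "T o\<^sub>L U \<in> closure M" if "T \<in> closure M" "U \<in> closure M" for T U
    by (rule step[of "\<lambda>T. T o\<^sub>L U"]) (use that comp1 in \<open>auto intro!: continuous_intros\<close>)
  have cs: "continuous_on X (scale_op c :: _ \<Rightarrow> 'a ell2 \<Rightarrow>\<^sub>L 'a ell2)" for X c
    by (intro linear_continuous_on bounded_linear_intro[where K = "cmod c"])
       (simp_all add: op.scale_right_distrib norm_scale_op mult.commute flip: scale_op_of_real)
  have scale: "scale_op c T \<in> closure M" if "T \<in> closure M" for c T
    by (rule step[of "scale_op c"])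
       (use that op.subspace_scale[OF M(2)] closure_subset cs in auto)
  \<comment> \<open>\<open>adj\<close> is a definite description and is controlled only on complex
    linear operators. Continuity is therefore proved on the closure of \<open>M\<close>, where
    \<open>adj\<close> is 1-Lipschitz.\<close>
  have ca: "continuous_on (closure M) adj"
    unfolding continuous_on_iff
  proof (intro ballI allI impI)
    fix T and e :: real
    assume T: "T \<in> closure M" and e: "0 < e"
    have "dist (adj U) (adj T) \<le> dist U T" if "U \<in> closure M" for U
    proof -
      have b: "U \<in> bounded_ops" "T \<in> bounded_ops" using that T cl by auto
      show ?thesis
        unfolding dist_norm adj_diff[OF b, symmetric]
        by (rule norm_adj_le[OF op.subspace_diff[OF subspace_bounded_ops b]])
    qed
    then show "\<exists>d>0. \<forall>U\<in>closure M. dist U T < d \<longrightarrow> dist (adj U) (adj T) < e"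
      using e by (meson order_le_less_trans)
  qed
  have "adj T \<in> closure M" if "T \<in> closure M" for T
    by (rule step[of adj]) (use that adj closure_subset ca in auto)
  moreover have "0 \<in> closure M" using op.subspace_0[OF M(2)] closure_subset by auto
  ultimately show ?thesis
    unfolding concrete_cstar_algebra_def op.subspace_def
    by (intro conjI ballI allI cl add scale comp' closed_closure) 
qed

lemma concrete_cstar_algebra_closure_span:
  fixes G :: "('a ell2 \<Rightarrow>\<^sub>L 'a ell2) set"
  assumes G: "G \<subseteq> bounded_ops"
    and comp: "\<And>T U. T \<in> G \<Longrightarrow> U \<in> G \<Longrightarrow> T o\<^sub>L U \<in> G"
    and adj: "\<And>T. T \<in> G \<Longrightarrow> adj T \<in> G"
  shows "concrete_cstar_algebra (closure (op.span G))"
proof (rule concrete_cstar_algebra_closure)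
  let ?M = "op.span G"
  show b: "?M \<subseteq> bounded_ops" by (rule op.span_minimal[OF G subspace_bounded_ops])
  show s: "op.subspace ?M" by (rule op.subspace_span)
  have comp1: "T o\<^sub>L U \<in> ?M" if T: "T \<in> G" and U: "U \<in> ?M" for T U
    using U
  proof (induction rule: op.span_induct_alt)
    case base
    then show ?case by (simp add: op.span_zero)
  next
    case (step c V W)
    have "T o\<^sub>L (scale_op c V + W) = scale_op c (T o\<^sub>L V) + (T o\<^sub>L W)"
      using G T by (auto simp: scale_op_compose bounded_bilinear.add_right[OF bounded_bilinear_blinfun_compose])
    then show ?case
      using step op.span_base[OF comp[OF T step(1)]] by (simp add: op.span_add op.span_scale)
  qed
  show "T o\<^sub>L U \<in> ?M" if "T \<in> ?M" "U \<in> ?M" for T U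
    using that(1)
  proof (induction rule: op.span_induct_alt)
    case base
    then show ?case by (simp add: op.span_zero)
  next
    case (step c V W)
    then show ?case
      using comp1[OF step(1) that(2)]
      by (simp add: scale_op_compose bounded_bilinear.add_left[OF bounded_bilinear_blinfun_compose]
          op.span_add op.span_scale)
  qed
  show "adj T \<in> ?M" if "T \<in> ?M" for T
  proof -
    \<comment> \<open>Complex linearity is carried through the induction because
      \<open>adj_add\<close> and \<open>adj_scale\<close> require it.\<close>
    have "T \<in> bounded_ops \<and> adj T \<in> ?M"
      using that
    proof (induction rule: op.span_induct_alt)
      case base
      then show ?case using op.span_zero b adj_zero by (metis subsetD)
    next
      case (step c V W)
      have V: "V \<in> bounded_ops" using step(1) G by auto
      have cV: "scale_op c V \<in> bounded_ops" by (rule op.subspace_scale[OF subspace_bounded_ops V])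
      have W: "W \<in> bounded_ops" "adj W \<in> ?M" using step(2) by auto
      show ?case
        using op.subspace_add[OF subspace_bounded_ops cV W(1)] op.span_base[OF adj[OF step(1)]] W
        by (simp add: adj_add[OF cV W(1)] adj_scale[OF V] op.span_add op.span_scale)
    qed
    then show ?thesis by simp
  qed
qed

section \<open>Images of contractive *-homomorphisms\<close>

text \<open>The cross term is computed from <y, a* a y> = <a y, a y>. The coefficients (1, 1) serve
  to bound the inverse of 1 + a* a, and (M^2, -1) to bound the norm of M^2 - a* a.\<close>

lemma norm_pythagoras_adj:
  assumes a: "a \<in> bounded_ops"
  shows "(norm (scale_ell2 (complex_of_real r) y
      + scale_ell2 (complex_of_real s) (blinfun_apply (adj a o\<^sub>L a) y)))\<^sup>2
    = r\<^sup>2 * (norm y)\<^sup>2 + 2 * r * s * (norm (blinfun_apply a y))\<^sup>2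
      + s\<^sup>2 * (norm (blinfun_apply (adj a o\<^sub>L a) y))\<^sup>2"
proof -
  have "inner y (blinfun_apply (adj a o\<^sub>L a) y) = (norm (blinfun_apply a y))\<^sup>2"
    by (simp add: inner_ell2_def cinner_adj_right[OF a] cinner_self_norm)
  moreover have "(norm (r *\<^sub>R y + s *\<^sub>R z))\<^sup>2
      = r\<^sup>2 * (norm y)\<^sup>2 + 2 * r * s * inner y z + s\<^sup>2 * (norm z)\<^sup>2" for z
    by (simp add: power2_norm_eq_inner inner_add_left inner_add_right inner_commute[of z y] del: dot_square_norm)
       (simp add: algebra_simps power2_eq_square)
  ultimately show ?thesis by (simp only: scaleR_ell2_def)
qed

text \<open>For y = R x one has x = y + a* a y, so the square of norm x is a sum of nonnegative
  terms containing the squares of norm y and of norm (a y). The bounds do not depend on the norm of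
  \<open>a\<close>.\<close>

lemma norm_one_plus_adj_bounds:
  assumes a: "a \<in> bounded_ops" and R: "(id_blinfun + (adj a o\<^sub>L a)) o\<^sub>L R = id_blinfun"
  shows "norm R \<le> 1" "norm (a o\<^sub>L R) \<le> 1"
proof -
  have *: "norm (blinfun_apply R x) \<le> norm x" "norm (blinfun_apply a (blinfun_apply R x)) \<le> norm x" for x
  proof -
    let ?y = "blinfun_apply R x"
    have "?y + blinfun_apply (adj a o\<^sub>L a) ?y = x"
      using arg_cong[OF R, of "\<lambda>T. blinfun_apply T x"] by (simp add: blinfun.add_left)
    then have "(norm x)\<^sup>2 = (norm ?y)\<^sup>2 + 2 * (norm (blinfun_apply a ?y))\<^sup>2
        + (norm (blinfun_apply (adj a o\<^sub>L a) ?y))\<^sup>2"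
      using norm_pythagoras_adj[OF a, of 1 ?y 1] by simp
    then have "(norm ?y)\<^sup>2 \<le> (norm x)\<^sup>2" "(norm (blinfun_apply a ?y))\<^sup>2 \<le> (norm x)\<^sup>2"
      by (smt (verit) zero_le_power2)+
    then show "norm ?y \<le> norm x" "norm (blinfun_apply a ?y) \<le> norm x"
      by (auto intro: power2_le_imp_le)
  qed
  show "norm R \<le> 1" "norm (a o\<^sub>L R) \<le> 1" by (rule norm_blinfun_bound; simp add: *)+
qed

text \<open>Write 1 + a* a = c - L with c = 1 + M^2 and L = M^2 - a* a. The equation (c - L) R = 1
  becomes the fixed point equation R = (1 + L R) / c. Since norm L is at most M^2 < c, its right
  side is a contraction of the complete set \<open>A\<close>, so the solution lies in
  \<open>A\<close>.\<close>

lemma one_plus_adj_right_inverse: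
  assumes A: "concrete_cstar_algebra A" and id: "id_blinfun \<in> A" and a: "a \<in> A"
  obtains R where "R \<in> A" "(id_blinfun + (adj a o\<^sub>L a)) o\<^sub>L R = id_blinfun"
proof -
  have b: "a \<in> bounded_ops" and sub: "op.subspace A"
    using A a by (auto simp: concrete_cstar_algebra_def)
  have comp: "T o\<^sub>L U \<in> A" if "T \<in> A" "U \<in> A" for T U
    using A that by (auto simp: concrete_cstar_algebra_def)
  have scale: "r *\<^sub>R T \<in> A" if "T \<in> A" for r T
    using op.subspace_scale[OF sub that, of "complex_of_real r"] by (simp add: scale_op_of_real)
  have aa: "adj a o\<^sub>L a \<in> A" using A a by (auto simp: concrete_cstar_algebra_def)
  define M c where "M = norm a" and "c = 1 + M\<^sup>2"
  have c: "0 < c" by (simp add: c_def add_pos_nonneg)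
  define L where "L = M\<^sup>2 *\<^sub>R id_blinfun - (adj a o\<^sub>L a)"
  have L: "L \<in> A" unfolding L_def by (intro op.subspace_diff[OF sub] scale id aa)
  have nL: "norm L \<le> M\<^sup>2"
  proof (rule norm_blinfun_bound)
    fix x
    \<comment> \<open>In the expansion of the square of norm (L x), the term from a* a x is absorbed
      by the negative cross term, since it is at most M^2 times the square of norm (a x).\<close>
    have "norm (blinfun_apply (adj a o\<^sub>L a) x) \<le> M * norm (blinfun_apply a x)"
      using order_trans[OF norm_blinfun mult_right_mono[OF norm_adj_le[OF b] norm_ge_zero]]
      by (simp add: M_def)
    then have "(norm (blinfun_apply (adj a o\<^sub>L a) x))\<^sup>2 \<le> (M * norm (blinfun_apply a x))\<^sup>2"
      by (rule power_mono) simp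
    moreover have "(norm (blinfun_apply L x))\<^sup>2 = M^4 * (norm x)\<^sup>2 - 2 * M\<^sup>2 * (norm (blinfun_apply a x))\<^sup>2
      + (norm (blinfun_apply (adj a o\<^sub>L a) x))\<^sup>2"
      using norm_pythagoras_adj[OF b, of "M\<^sup>2" x "-1"]
      by (simp add: L_def blinfun.diff_left blinfun.scaleR_left scaleR_ell2_def
          del: blinfun_apply_blinfun_compose)
    moreover have "0 \<le> M\<^sup>2 * (norm (blinfun_apply a x))\<^sup>2" by simp
    ultimately have "(norm (blinfun_apply L x))\<^sup>2 \<le> M^4 * (norm x)\<^sup>2"
      unfolding power_mult_distrib by linarith
    then have "(norm (blinfun_apply L x))\<^sup>2 \<le> (M\<^sup>2 * norm x)\<^sup>2"
      by (simp add: power_mult_distrib flip: power_mult)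
    then show "norm (blinfun_apply L x) \<le> M\<^sup>2 * norm x"
      by (rule power2_le_imp_le) simp
  qed simp
  let ?f = "\<lambda>R. (1 / c) *\<^sub>R (id_blinfun + (L o\<^sub>L R))"
  have "\<exists>!R\<in>A. ?f R = R"
  proof (rule Banach_fix)
    show "complete A" using A by (auto simp: concrete_cstar_algebra_def complete_eq_closed)
    show "A \<noteq> {}" using id by auto
    show "0 \<le> M\<^sup>2 / c" "M\<^sup>2 / c < 1" using c by (auto simp: c_def)
    show "?f ` A \<subseteq> A" by (auto intro!: scale op.subspace_add[OF sub] id comp L)
    show "dist (?f x) (?f y) \<le> M\<^sup>2 / c * dist x y" for x y
    proof -
      have "?f x - ?f y = (1 / c) *\<^sub>R (L o\<^sub>L (x - y))"
        by (simp add: bounded_bilinear.diff_right[OF bounded_bilinear_blinfun_compose]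
            flip: scaleR_diff_right)
      then have "norm (?f x - ?f y) = norm (L o\<^sub>L (x - y)) / c" using c by simp
      also have "\<dots> \<le> M\<^sup>2 * norm (x - y) / c"
        by (intro divide_right_mono order_trans[OF norm_blinfun_compose] mult_right_mono nL) (use c in auto)
      finally show "dist (?f x) (?f y) \<le> M\<^sup>2 / c * dist x y" by (simp add: dist_norm)
    qed
  qed
  then obtain R where R: "R \<in> A" "?f R = R" by auto
  have "id_blinfun + (L o\<^sub>L R) = c *\<^sub>R R"
    using arg_cong[OF R(2), of "scaleR c"] c by simp
  moreover have "id_blinfun o\<^sub>L R = R" by (rule blinfun_eqI) simp
  ultimately have "(id_blinfun + (adj a o\<^sub>L a)) o\<^sub>L R = id_blinfun"
    by (simp add: L_def c_def algebra_simps
        bounded_bilinear.diff_left[OF bounded_bilinear_blinfun_compose]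
        bounded_bilinear.add_left[OF bounded_bilinear_blinfun_compose]
        bounded_bilinear.scaleR_left[OF bounded_bilinear_blinfun_compose])
  with R(1) show thesis by (rule that)
qed

text \<open>This isolates the properties of the compression that force its image to be closed. The
  target consists of all bounded operators, because the image is not yet known to be a C*-algebra.
  Contractivity is immediate for a compression, so it enters as an assumption instead of through
  spectral theory.\<close>

locale contractive_hom =
  fixes A :: "('a ell2 \<Rightarrow>\<^sub>L 'a ell2) set" and h :: "('a ell2 \<Rightarrow>\<^sub>L 'a ell2) \<Rightarrow> ('b ell2 \<Rightarrow>\<^sub>L 'b ell2)"
  assumes cstar: "concrete_cstar_algebra A" and unit: "id_blinfun \<in> A"
    and hom: "star_hom (op_algebra A) (op_algebra bounded_ops) h"
    and hom_unit: "h id_blinfun = id_blinfun"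
    and contractive: "T \<in> A \<Longrightarrow> norm (h T) \<le> norm T"
begin

lemma algebra:
  "T \<in> A \<Longrightarrow> T \<in> bounded_ops" "op.subspace A" "closed A"
  "T \<in> A \<Longrightarrow> U \<in> A \<Longrightarrow> T o\<^sub>L U \<in> A" "T \<in> A \<Longrightarrow> adj T \<in> A"
  using cstar by (auto simp: concrete_cstar_algebra_def)

lemma hom_simps:
  "T \<in> A \<Longrightarrow> h T \<in> bounded_ops"
  "T \<in> A \<Longrightarrow> U \<in> A \<Longrightarrow> h (T + U) = h T + h U"
  "T \<in> A \<Longrightarrow> h (scale_op c T) = scale_op c (h T)"
  "T \<in> A \<Longrightarrow> U \<in> A \<Longrightarrow> h (T o\<^sub>L U) = h T o\<^sub>L h U"
  "T \<in> A \<Longrightarrow> h (adj T) = adj (h T)"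
  using hom by (auto simp: star_hom_def op_algebra_def)

lemma hom_scaleR: "T \<in> A \<Longrightarrow> h (r *\<^sub>R T) = r *\<^sub>R h T"
  using hom_simps(3)[of T "complex_of_real r"] by (simp add: scale_op_of_real)

lemma hom_zero: "h 0 = 0"
  using hom_scaleR[OF unit, of 0] by simp

lemma scaleR_mem: "T \<in> A \<Longrightarrow> r *\<^sub>R T \<in> A"
  using op.subspace_scale[OF algebra(2), of T "complex_of_real r"] by (simp add: scale_op_of_real)

lemma hom_diff: "T \<in> A \<Longrightarrow> U \<in> A \<Longrightarrow> h (T - U) = h T - h U"
  using hom_simps(2)[of T "(-1) *\<^sub>R U"] hom_scaleR[of U "-1"] scaleR_mem[of U "-1"] by simp

text \<open>
  The lift of \<open>h a\<close> is a rescaled \<open>a (1 + a* a)\<^sup>-\<^sup>1\<close>: it is bounded independently of the norm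
  of \<open>a\<close>, and differs from \<open>a\<close> by a term of third order in \<open>a\<close>.
\<close>

lemma approximate_lift:
  assumes a: "a \<in> A"
  obtains a' where "a' \<in> A" "norm a' \<le> 2 * norm (h a)" "norm (h a - h a') \<le> norm (h a) / 4"
proof (cases "h a = 0")
  case True
  show thesis by (rule that[of 0]) (simp_all add: True hom_zero op.subspace_0[OF algebra(2)])
next
  case False
  \<comment> \<open>The scaling gives \<open>h d\<close> norm 1/2, so that an error of third order
    is at most 1/8. Undoing it multiplies by 2 * norm (h a), which turns 1/8 into norm (h a) /
    4.\<close>
  define t where "t = 1 / (2 * norm (h a))"
  have t: "0 < t" using False by (simp add: t_def)
  define d where "d = t *\<^sub>R a"
  have d: "d \<in> A" "h d = t *\<^sub>R h a" using a by (auto simp: d_def scaleR_mem hom_scaleR)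
  have nd: "norm (h d) = 1 / 2" using False by (simp add: d(2) t_def)
  obtain R where R: "R \<in> A" "(id_blinfun + (adj d o\<^sub>L d)) o\<^sub>L R = id_blinfun"
    by (rule one_plus_adj_right_inverse[OF cstar unit d(1)])
  define g where "g = d o\<^sub>L R"
  have g: "g \<in> A" "norm g \<le> 1" "h g = h d o\<^sub>L h R"
    using d R norm_one_plus_adj_bounds[OF algebra(1)[OF d(1)] R(2)]
    by (auto simp: g_def algebra hom_simps)
  have hR: "(id_blinfun + (adj (h d) o\<^sub>L h d)) o\<^sub>L h R = id_blinfun"
    using arg_cong[OF R(2), of h] d(1) R(1) unit op.subspace_add[OF algebra(2)]
    by (simp add: hom_simps algebra hom_unit)
  \<comment> \<open>Inserting 1 = (1 + d* d) R under \<open>h\<close> cancels the leading term and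
    leaves a product with three factors of norm at most 1/2.\<close>
  have "h d - h g = (h d o\<^sub>L ((id_blinfun + (adj (h d) o\<^sub>L h d)) o\<^sub>L h R)) - (h d o\<^sub>L h R)"
    unfolding hR g(3) by (rule blinfun_eqI) (simp add: blinfun.diff_left)
  also have "\<dots> = h d o\<^sub>L (adj (h d) o\<^sub>L (h d o\<^sub>L h R))"
    by (rule blinfun_eqI)
       (simp add: blinfun.add_left blinfun.diff_left blinfun.add_right)
  finally have "norm (h d - h g) \<le> norm (h d) * (norm (adj (h d)) * (norm (h d) * norm (h R)))"
    by (simp only:) (intro order_trans[OF norm_blinfun_compose] mult_left_mono norm_ge_zero order_refl)
  also have "\<dots> \<le> 1/2 * (1/2 * (1/2 * 1))"
    unfolding nd
    using norm_adj_le[OF hom_simps(1)[OF d(1)]] 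
      norm_one_plus_adj_bounds(1)[OF hom_simps(1)[OF d(1)] hR]
    by (intro mult_mono) (auto simp: nd)
  finally have e: "norm (h d - h g) \<le> 1 / 8" by simp
  show thesis
  proof (rule that[of "(1 / t) *\<^sub>R g"])
    show "(1 / t) *\<^sub>R g \<in> A" by (rule scaleR_mem[OF g(1)])
    show "norm ((1 / t) *\<^sub>R g) \<le> 2 * norm (h a)"
      using t g(2) by (simp add: t_def mult_left_le)
    have "h a = (1 / t) *\<^sub>R h d" using t by (simp add: d(2))
    then have "h a - h ((1 / t) *\<^sub>R g) = (1 / t) *\<^sub>R (h d - h g)"
      by (simp add: hom_scaleR[OF g(1)] scaleR_diff_right)
    then have "norm (h a - h ((1 / t) *\<^sub>R g)) = norm (h d - h g) / t" using t by simp
    also have "\<dots> \<le> (1 / 8) / t" using t e by (intro divide_right_mono) auto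
    also have "\<dots> = norm (h a) / 4" by (simp add: t_def)
    finally show "norm (h a - h ((1 / t) *\<^sub>R g)) \<le> norm (h a) / 4" .
  qed
qed

section \<open>The image is closed, hence a C*-algebra\<close>

lemma op_subspace_image: "op.subspace (h ` A)"
  unfolding op.subspace_def
proof (intro conjI ballI allI)
  show "0 \<in> h ` A" using op.subspace_0[OF algebra(2)] hom_zero by (metis image_eqI)
next
  fix T U assume "T \<in> h ` A" "U \<in> h ` A"
  then show "T + U \<in> h ` A"
    using op.subspace_add[OF algebra(2)] by (auto simp flip: hom_simps(2))
next
  fix c T assume "T \<in> h ` A"
  then show "scale_op c T \<in> h ` A"
    using op.subspace_scale[OF algebra(2)] by (auto simp flip: hom_simps(3))
qed

text \<open>One step of the successive approximation in \<open>closed_image\<close>. Choosing h a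
  within norm T / 8 of T bounds norm (h a) by 9/8 norm T. The lift then has norm at most 9/4 norm T,
  and the total error is at most (1/8 + 9/32) norm T.\<close>

lemma approximate_lift_closure:
  assumes T: "T \<in> closure (h ` A)"
  shows "\<exists>a\<in>A. norm a \<le> 4 * norm T \<and> norm (T - h a) \<le> norm T / 2"
proof (cases "T = 0")
  case True
  then show ?thesis using hom_zero op.subspace_0[OF algebra(2)] by (intro bexI[of _ 0]) auto
next
  case False
  then obtain a where a: "a \<in> A" "dist (h a) T < norm T / 8"
    using T closure_approachable[of T "h ` A"]
    by (metis imageE zero_less_divide_iff zero_less_norm_iff zero_less_numeral)
  obtain a' where a': "a' \<in> A" "norm a' \<le> 2 * norm (h a)" "norm (h a - h a') \<le> norm (h a) / 4"
    by (rule approximate_lift[OF a(1)])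
  have "norm (h a) \<le> norm (h a - T) + norm T" by (metis diff_add_cancel norm_triangle_ineq)
  moreover have "norm (T - h a') \<le> norm (h a - T) + norm (h a - h a')"
    by (metis norm_diff_triangle_le norm_minus_commute order_refl)
  ultimately have "norm a' \<le> 4 * norm T" "norm (T - h a') \<le> norm T / 2"
    using a(2) a'(2,3) norm_ge_zero[of T] unfolding dist_norm by linarith+
  then show ?thesis using a'(1) by blast
qed

text \<open>Successive approximation as in the open mapping theorem: lift approximately, subtract,
  and repeat. The remainders halve, so the lifts form an absolutely convergent series whose sum is
  an exact preimage.\<close>

lemma closed_image: "closed (h ` A)"
proof -
  let ?B = "closure (h ` A)"
  have "T \<in> h ` A" if T: "T \<in> ?B" for T
  proof -
    obtain \<sigma> where \<sigma>: "\<And>T. T \<in> ?B \<Longrightarrow> \<sigma> T \<in> A"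
      "\<And>T. T \<in> ?B \<Longrightarrow> norm (\<sigma> T) \<le> 4 * norm T" "\<And>T. T \<in> ?B \<Longrightarrow> norm (T - h (\<sigma> T)) \<le> norm T / 2"
      using approximate_lift_closure by metis
    \<comment> \<open>Remainders stay in the closure, so the lift \<open>\<sigma>\<close> can be
      applied to them again.\<close>
    have diff: "T - h a \<in> ?B" if "T \<in> ?B" "a \<in> A" for T a
    proof -
      have "(\<lambda>U. U - h a) ` ?B \<subseteq> ?B"
        by (rule image_closure_subset)
           (use that(2) op.subspace_diff[OF op_subspace_image] closure_subset[of "h ` A"]
             in \<open>force intro!: continuous_intros\<close>)+
      with that(1) show ?thesis by auto
    qed
    define E where "E n = ((\<lambda>U. U - h (\<sigma> U)) ^^ n) T" for n
    have E_Suc: "E (Suc n) = E n - h (\<sigma> (E n))" for n by (simp add: E_def)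
    have E0: "E 0 = T" by (simp add: E_def)
    have EB: "E n \<in> ?B" for n
      by (induction n) (simp_all add: E0 T E_Suc diff \<sigma>(1))
    have nE: "norm (E n) \<le> (1 / 2) ^ n * norm T" for n
    proof (induction n)
      case (Suc n)
      then show ?case using \<sigma>(3)[OF EB[of n]] by (simp add: E_Suc)
    qed (simp add: E0)
    have Elim: "E \<longlonglongrightarrow> 0"
    proof (rule tendsto_0_le[where K = "norm T"])
      show "(\<lambda>n. (1 / 2 :: real) ^ n) \<longlonglongrightarrow> 0" by (rule LIMSEQ_power_zero) simp
      show "\<forall>\<^sub>F n in sequentially. norm (E n) \<le> norm ((1 / 2 :: real) ^ n) * norm T"
        by (rule always_eventually) (use nE in \<open>auto simp: norm_power\<close>)
    qed
    have "summable (\<lambda>n. \<sigma> (E n))"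
    proof (rule summable_comparison_test')
      show "summable (\<lambda>n. (4 * norm T) * (1 / 2 :: real) ^ n)"
        by (intro summable_mult summable_geometric) simp
      show "norm (\<sigma> (E n)) \<le> (4 * norm T) * (1 / 2) ^ n" if "0 \<le> n" for n
        using \<sigma>(2)[OF EB[of n]] nE[of n] by (simp add: mult_ac)
    qed
    then obtain a where a: "(\<lambda>n. \<Sum>i<n. \<sigma> (E i)) \<longlonglongrightarrow> a"
      by (auto simp: summable_def sums_def)
    \<comment> \<open>The images of the lifts telescope, leaving the remainder
      \<open>E n\<close>.\<close>
    have s: "(\<Sum>i<n. \<sigma> (E i)) \<in> A \<and> h (\<Sum>i<n. \<sigma> (E i)) = T - E n" for n
    proof (induction n)
      case 0
      then show ?case
        using hom_zero op.subspace_0[OF algebra(2)] by (simp add: E0)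
    next
      case (Suc n)
      then show ?case
        using \<sigma>(1)[OF EB[of n]] op.subspace_add[OF algebra(2)] by (simp add: hom_simps(2) E_Suc)
    qed
    have aA: "a \<in> A" using closed_sequentially[OF algebra(3) _ a] s by auto
    \<comment> \<open>Continuity of \<open>h\<close> along this sequence comes from contractivity on
      \<open>A\<close>; nothing is assumed about \<open>h\<close> outside \<open>A\<close>.\<close>
    have "(\<lambda>n. h a - h (\<Sum>i<n. \<sigma> (E i))) \<longlonglongrightarrow> 0"
    proof (rule tendsto_0_le[where K = 1])
      show "(\<lambda>n. a - (\<Sum>i<n. \<sigma> (E i))) \<longlonglongrightarrow> 0" using tendsto_diff[OF tendsto_const a, of a] by simp
      show "\<forall>\<^sub>F n in sequentially. norm (h a - h (\<Sum>i<n. \<sigma> (E i))) \<le> norm (a - (\<Sum>i<n. \<sigma> (E i))) * 1"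
        using s aA contractive[OF op.subspace_diff[OF algebra(2)]]
        by (intro always_eventually allI) (metis hom_diff mult.right_neutral)
    qed
    moreover have "(\<lambda>n. h a - h (\<Sum>i<n. \<sigma> (E i))) \<longlonglongrightarrow> h a - (T - 0)"
      using tendsto_diff[OF tendsto_const tendsto_diff[OF tendsto_const Elim]] s by simp
    ultimately have "h a - (T - 0) = 0" by (rule LIMSEQ_unique[rotated])
    then show ?thesis using aA by auto
  qed
  then show ?thesis by (metis closure_subset closure_closed closed_closure subsetI subset_antisym)
qed

lemma concrete_cstar_algebra_image: "concrete_cstar_algebra (h ` A)"
  unfolding concrete_cstar_algebra_def
proof (intro conjI op_subspace_image closed_image ballI)
  show "h ` A \<subseteq> bounded_ops" using hom_simps(1) by blast
  show "T o\<^sub>L U \<in> h ` A" if "T \<in> h ` A" "U \<in> h ` A" for T U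
    using that by (auto simp: algebra(4) simp flip: hom_simps(4))
  show "adj T \<in> h ` A" if "T \<in> h ` A" for T
    using that by (auto simp: algebra(5) simp flip: hom_simps(5))
qed

end

section \<open>Inverse semigroups and their left regular representation\<close>

context inverse_semigroup
begin

lemma mult_star_mult: "x * x\<^sup>\<star> * x = x" "x\<^sup>\<star> * x * x\<^sup>\<star> = x\<^sup>\<star>"
  using star_iff by auto

lemma star_eqI: "x * y * x = x \<Longrightarrow> y * x * y = y \<Longrightarrow> x\<^sup>\<star> = y"
  using star_iff[of x y] by simp

lemma star_star: "(x\<^sup>\<star>)\<^sup>\<star> = x"
  by (rule star_eqI) (rule mult_star_mult)+

lemma star_idem: "e * e = e \<Longrightarrow> e\<^sup>\<star> = e"
  by (rule star_eqI) simp_all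

lemma idem_star_mult: "(x\<^sup>\<star> * x) * (x\<^sup>\<star> * x) = x\<^sup>\<star> * x"
  by (metis mult_star_mult(1) mult.assoc)

lemma idem_mult_star: "(x * x\<^sup>\<star>) * (x * x\<^sup>\<star>) = x * x\<^sup>\<star>"
  by (metis mult_star_mult(1) mult.assoc)

text \<open>Let x be the inverse of e f. Then f x e is also an inverse of e f, so x = f x e by
  uniqueness, which makes x idempotent. An idempotent is its own inverse, hence e f = x.\<close>

lemma idem_mult:
  assumes e: "e * e = e" and f: "f * f = f"
  shows "(e * f) * (e * f) = e * f"
proof -
  define x where "x = (e * f)\<^sup>\<star>"
  have x: "e * (f * (x * (e * f))) = e * f" "x * (e * (f * x)) = x"
    using mult_star_mult[of "e * f"] by (simp_all add: x_def mult.assoc)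
  have ee: "e * (e * y) = e * y" and ff: "f * (f * y) = f * y" for y
    by (metis e mult.assoc) (metis f mult.assoc)
  have "x = f * (x * e)"
    unfolding x_def
  proof (rule star_eqI, unfold x_def[symmetric])
    show "e * f * (f * (x * e)) * (e * f) = e * f" by (simp add: mult.assoc ee ff x)
    have "f * (x * e) * (e * f) * (f * (x * e)) = f * (x * (e * (f * x))) * e"
      by (simp add: mult.assoc ee ff)
    then show "f * (x * e) * (e * f) * (f * (x * e)) = f * (x * e)" by (simp add: x mult.assoc)
  qed
  then have "x * x = f * (x * (e * (f * x))) * e" by (metis mult.assoc)
  then have "x * x = x" using \<open>x = f * (x * e)\<close> by (simp add: x(2) mult.assoc)
  then have "x\<^sup>\<star> = x" by (rule star_idem)
  then have "e * f = x" by (simp add: x_def star_star)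
  with \<open>x * x = x\<close> show ?thesis by simp
qed

text \<open>Both e f and f e are inverses of the idempotent e f.\<close>

lemma idem_commute:
  assumes e: "e * e = e" and f: "f * f = f"
  shows "e * f = f * e"
proof -
  have ee: "e * (e * y) = e * y" and ff: "f * (f * y) = f * y" for y
    by (metis e mult.assoc) (metis f mult.assoc)
  have "(e * f)\<^sup>\<star> = f * e"
    by (rule star_eqI)
       (use idem_mult[OF e f] idem_mult[OF f e] in \<open>simp_all add: mult.assoc ee ff\<close>)
  moreover have "(e * f)\<^sup>\<star> = e * f" by (rule star_idem[OF idem_mult[OF e f]])
  ultimately show ?thesis by simp
qed

text \<open>Both inverse identities reduce to commuting the idempotents x* x and y y*.\<close>

lemma star_mult: "(x * y)\<^sup>\<star> = y\<^sup>\<star> * x\<^sup>\<star>"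
proof (rule star_eqI)
  have c: "(x\<^sup>\<star> * x) * (y * y\<^sup>\<star>) = (y * y\<^sup>\<star>) * (x\<^sup>\<star> * x)"
    by (rule idem_commute[OF idem_star_mult idem_mult_star])
  have "x * y * (y\<^sup>\<star> * x\<^sup>\<star>) * (x * y) = x * ((y * y\<^sup>\<star>) * (x\<^sup>\<star> * x)) * y"
    by (simp add: mult.assoc)
  also have "\<dots> = (x * x\<^sup>\<star> * x) * (y * y\<^sup>\<star> * y)" unfolding c[symmetric] by (simp only: mult.assoc)
  finally show "x * y * (y\<^sup>\<star> * x\<^sup>\<star>) * (x * y) = x * y" by (simp add: mult_star_mult)
  have "y\<^sup>\<star> * x\<^sup>\<star> * (x * y) * (y\<^sup>\<star> * x\<^sup>\<star>) = y\<^sup>\<star> * ((x\<^sup>\<star> * x) * (y * y\<^sup>\<star>)) * x\<^sup>\<star>"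
    by (simp add: mult.assoc)
  also have "\<dots> = (y\<^sup>\<star> * y * y\<^sup>\<star>) * (x\<^sup>\<star> * x * x\<^sup>\<star>)" unfolding c by (simp add: mult.assoc)
  finally show "y\<^sup>\<star> * x\<^sup>\<star> * (x * y) * (y\<^sup>\<star> * x\<^sup>\<star>) = y\<^sup>\<star> * x\<^sup>\<star>" by (simp add: mult_star_mult)
qed

text \<open>This matches the domain conditions in \<open>left_regular\<close>: the basis vector at r
  survives the product p q exactly when it survives q and its image survives p.\<close>

lemma source_mult_iff:
  "(p * q)\<^sup>\<star> * (p * q) * r = r \<longleftrightarrow> q\<^sup>\<star> * q * r = r \<and> p\<^sup>\<star> * p * (q * r) = q * r"
proof
  assume r: "(p * q)\<^sup>\<star> * (p * q) * r = r"
  then have r': "q\<^sup>\<star> * (p\<^sup>\<star> * (p * (q * r))) = r" by (simp add: star_mult mult.assoc)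
  have c: "(q * q\<^sup>\<star>) * (p\<^sup>\<star> * p) = (p\<^sup>\<star> * p) * (q * q\<^sup>\<star>)"
    by (rule idem_commute[OF idem_mult_star idem_star_mult])
  have "q\<^sup>\<star> * q * r = (q\<^sup>\<star> * q * q\<^sup>\<star>) * (p\<^sup>\<star> * (p * (q * r)))"
    by (subst r'[symmetric]) (simp add: mult.assoc)
  then have 1: "q\<^sup>\<star> * q * r = r" using r' by (simp only: mult_star_mult)
  have "q * r = ((q * q\<^sup>\<star>) * (p\<^sup>\<star> * p)) * (q * r)"
    by (subst r'[symmetric]) (simp add: mult.assoc)
  also have "\<dots> = (p\<^sup>\<star> * p) * (q * q\<^sup>\<star> * q) * r" unfolding c by (simp add: mult.assoc)
  also have "\<dots> = p\<^sup>\<star> * p * (q * r)" unfolding mult_star_mult(1) by (simp only: mult.assoc)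
  finally show "q\<^sup>\<star> * q * r = r \<and> p\<^sup>\<star> * p * (q * r) = q * r" using 1 by simp
next
  assume "q\<^sup>\<star> * q * r = r \<and> p\<^sup>\<star> * p * (q * r) = q * r"
  then show "(p * q)\<^sup>\<star> * (p * q) * r = r" by (simp add: star_mult mult.assoc)
qed

text \<open>In terms of matrix entries: p sends the basis vector at q to the one at r exactly when
  its inverse sends r back to q. Thus the two matrices are transposes of each other.\<close>

lemma left_mult_swap: "p\<^sup>\<star> * p * q = q \<and> p * q = r \<longleftrightarrow> p * p\<^sup>\<star> * r = r \<and> p\<^sup>\<star> * r = q"
  by (auto simp: mult.assoc)

end

section \<open>The left regular representation and its C*-algebra\<close>

lemma left_regular_mult: "left_regular (p * q) = left_regular p o\<^sub>L left_regular q"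
  by (rule bounded_op_eqI)
     (simp_all add: left_regular bounded_ops_comp source_mult_iff, simp add: mult.assoc)

lemma left_regular_star: "left_regular (p\<^sup>\<star>) = adj (left_regular p)"
proof (rule adj_eq_on_basis[symmetric])
  fix s t :: 'a
  show "coord (blinfun_apply (left_regular (p\<^sup>\<star>)) (ket t)) s
      = cnj (coord (blinfun_apply (left_regular p) (ket s)) t)"
    using left_mult_swap[of p s t]
    by (auto simp: left_regular star_star ket.rep_eq zero_ell2.rep_eq)
qed (rule left_regular)+

lemma concrete_cstar_algebra_reduced_cstar:
  "concrete_cstar_algebra (reduced_cstar :: ('p::inverse_semigroup ell2 \<Rightarrow>\<^sub>L 'p ell2) set)"
  unfolding reduced_cstar_def
  by (rule concrete_cstar_algebra_closure_span)
     (auto simp: left_regular simp flip: left_regular_mult left_regular_star)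

lemma left_regular_mem: "left_regular p \<in> reduced_cstar"
  unfolding reduced_cstar_def using op.span_base[of "left_regular p"] closure_subset by blast

section \<open>Quotients of *-algebras\<close>

text \<open>The setting for factoring a homomorphism through \<open>quotient_algebra\<close>. That
  \<open>N\<close> is killed is expressed through \<open>add\<close>, since the record
  \<open>star_algebra\<close> carries neither zero nor negation.\<close>

locale star_hom_kernel =
  fixes A :: "'x star_algebra" and B :: "'y star_algebra" and N :: "'x set" and h :: "'x \<Rightarrow> 'y"
  assumes hom: "star_hom A B h"
    and closed: "x \<in> elems A \<Longrightarrow> y \<in> elems A \<Longrightarrow> add A x y \<in> elems A"
      "x \<in> elems A \<Longrightarrow> scale A c x \<in> elems A"
      "x \<in> elems A \<Longrightarrow> y \<in> elems A \<Longrightarrow> mult A x y \<in> elems A"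
      "x \<in> elems A \<Longrightarrow> invol A x \<in> elems A"
    and N: "N \<noteq> {}" "N \<subseteq> elems A"
    and kernel: "x \<in> elems A \<Longrightarrow> n \<in> N \<Longrightarrow> h (add A x n) = h x"
begin

text \<open>The quotient operations are unions of cosets over all representatives. This invariant
  passes to unions directly, so no union has to be identified with a single coset.\<close>

definition lifts :: "'y \<Rightarrow> 'x set \<Rightarrow> bool" where
  "lifts v X \<longleftrightarrow> X \<noteq> {} \<and> X \<subseteq> elems A \<and> (\<forall>x\<in>X. h x = v)"

definition quot :: "'x set \<Rightarrow> 'y" where
  "quot X = h (SOME x. x \<in> X)"

lemma quot_eqI: "lifts v X \<Longrightarrow> quot X = v"
  unfolding lifts_def quot_def by (metis some_in_eq)

lemma lifts_coset: "x \<in> elems A \<Longrightarrow> lifts (h x) (coset A N x)"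
  using N closed(1) kernel unfolding lifts_def coset_def by blast

lemma lifts_Union:
  "I \<noteq> {} \<Longrightarrow> (\<And>i. i \<in> I \<Longrightarrow> lifts v (F i)) \<Longrightarrow> lifts v (\<Union>i\<in>I. F i)"
  unfolding lifts_def by blast

lemma quot_coset: "x \<in> elems A \<Longrightarrow> quot (coset A N x) = h x"
  by (intro quot_eqI lifts_coset)

lemma hom_eqs:
  "x \<in> elems A \<Longrightarrow> y \<in> elems A \<Longrightarrow> h (add A x y) = add B (h x) (h y)"
  "x \<in> elems A \<Longrightarrow> h (scale A c x) = scale B c (h x)"
  "x \<in> elems A \<Longrightarrow> y \<in> elems A \<Longrightarrow> h (mult A x y) = mult B (h x) (h y)"
  "x \<in> elems A \<Longrightarrow> h (invol A x) = invol B (h x)"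
  using hom by (auto simp: star_hom_def)

lemma quot_image: "quot ` elems (quotient_algebra A N) = h ` elems A"
  by (auto simp: quotient_algebra_def quot_coset image_iff)

lemma star_hom_quot: "star_hom (quotient_algebra A N) B quot"
proof -
  have cos: "\<exists>x\<in>elems A. lifts (h x) X" if "X \<in> elems (quotient_algebra A N)" for X
    using that lifts_coset by (auto simp: quotient_algebra_def)
  have member: "x' \<in> elems A \<and> h x' = v" if "lifts v X" "x' \<in> X" for v X x'
    using that by (auto simp: lifts_def)
  have nonempty: "X \<noteq> {}" if "lifts v X" for v X
    using that by (auto simp: lifts_def)
  have lift: "lifts v (coset A N x)" if "x \<in> elems A" "h x = v" for v x
    using lifts_coset[OF that(1)] that(2) by simp
  show ?thesis
    unfolding star_hom_def
  proof (intro conjI ballI allI)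
    show "quot ` elems (quotient_algebra A N) \<subseteq> elems B"
      unfolding quot_image using hom by (simp add: star_hom_def)
  next
    fix X Y assume "X \<in> elems (quotient_algebra A N)" "Y \<in> elems (quotient_algebra A N)"
    then obtain x y where x: "lifts (h x) X" and y: "lifts (h y) Y" using cos by blast
    show "quot (add (quotient_algebra A N) X Y) = add B (quot X) (quot Y)"
      unfolding quot_eqI[OF x] quot_eqI[OF y] quotient_algebra_def star_algebra.simps
      by (rule quot_eqI, intro lifts_Union lift nonempty[OF x] nonempty[OF y])
         (use member[OF x] member[OF y] closed hom_eqs in auto)
    show "quot (mult (quotient_algebra A N) X Y) = mult B (quot X) (quot Y)"
      unfolding quot_eqI[OF x] quot_eqI[OF y] quotient_algebra_def star_algebra.simps
      by (rule quot_eqI, intro lifts_Union lift nonempty[OF x] nonempty[OF y])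
         (use member[OF x] member[OF y] closed hom_eqs in auto)
  next
    fix X assume "X \<in> elems (quotient_algebra A N)"
    then obtain x where x: "lifts (h x) X" using cos by blast
    show "quot (scale (quotient_algebra A N) c X) = scale B c (quot X)" for c
      unfolding quot_eqI[OF x] quotient_algebra_def star_algebra.simps
      by (rule quot_eqI, intro lifts_Union lift nonempty[OF x])
         (use member[OF x] closed hom_eqs in auto)
    show "quot (invol (quotient_algebra A N) X) = invol B (quot X)"
      unfolding quot_eqI[OF x] quotient_algebra_def star_algebra.simps
      by (rule quot_eqI, intro lifts_Union lift nonempty[OF x])
         (use member[OF x] closed hom_eqs in auto)
  qed
qed

end

section \<open>Compression to the left translations\<close>

definition translation_elem :: "'s::left_cancel_monoid \<Rightarrow> 's left_hull" where
  "translation_elem s = Abs_left_hull (left_translation s)"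

lemma pfun_translation_elem: "pfun (pbij (translation_elem s)) t = Some (s * t)"
  by (simp add: translation_elem_def Abs_left_hull_inverse left_hull_set.translation left_translation.rep_eq)

lemma pfun_eqI: "(\<And>s. pfun (pbij f) s = pfun (pbij g) s) \<Longrightarrow> f = g"
  by (metis ext pfun_inject pbij_inject)

lemma translation_elem_inject: "translation_elem s = translation_elem t \<Longrightarrow> s = t"
  by (metis pfun_translation_elem mult_1_right option.inject)

lemma pfun_star_iff: "pfun (f\<^sup>\<star>) t = Some s \<longleftrightarrow> pfun f s = Some t"
  using pfun[of f] by (simp add: star_partial_bij.rep_eq inverse_map_iff)

lemma pfun_mult: "pfun (f * g) s = (case pfun g s of None \<Rightarrow> None | Some t \<Rightarrow> pfun f t)"
  by (simp add: times_partial_bij.rep_eq map_comp_def)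

text \<open>For left translations this is associativity. It passes to composites, and also to
  inverses because the condition is symmetric in argument and value.\<close>

lemma left_hull_right_equivariant:
  "f \<in> left_hull_set \<Longrightarrow> pfun f s = Some t \<Longrightarrow> pfun f (s * r) = Some (t * r)"
proof (induction arbitrary: s t r rule: left_hull_set.induct)
  case (translation s)
  then show ?case by (auto simp: left_translation.rep_eq mult.assoc)
next
  case (mult f g)
  then show ?case by (auto simp: pfun_mult split: option.splits)
next
  case (star f)
  then show ?case by (auto simp: pfun_star_iff)
qed

lemma left_regular_translation_elem:
  "blinfun_apply (left_regular f) (ket (translation_elem s))
    = (case pfun (pbij f) s of Some t \<Rightarrow> ket (translation_elem t) | None \<Rightarrow> 0)"
proof (cases "pfun (pbij f) s")
  case None
  \<comment> \<open>Evaluation at 1 separates the two elements: the product is undefined there,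
    whereas the translation by \<open>s\<close> has value \<open>s\<close>.\<close>
  then have "pfun (pbij (f\<^sup>\<star> * f * translation_elem s)) 1 = None"
    by (simp add: times_left_hull.rep_eq pfun_mult pfun_translation_elem)
  then have "f\<^sup>\<star> * f * translation_elem s \<noteq> translation_elem s"
    by (metis option.distinct(1) pfun_translation_elem)
  with None show ?thesis by (simp add: left_regular)
next
  case (Some t)
  \<comment> \<open>Equivariance propagates f(s) = t to f(s r) = t r for every r, which gives
    equality of the maps at all points.\<close>
  note eq = left_hull_right_equivariant[OF pbij Some]
  have "f\<^sup>\<star> * f * translation_elem s = translation_elem s"
    by (rule pfun_eqI)
       (simp add: times_left_hull.rep_eq star_left_hull.rep_eq pfun_mult pfun_translation_elem eq
         pfun_star_iff)
  moreover have "f * translation_elem s = translation_elem t"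
    by (rule pfun_eqI)
       (simp add: times_left_hull.rep_eq pfun_mult pfun_translation_elem eq)
  ultimately show ?thesis using Some by (simp add: left_regular)
qed

section \<open>The isometry onto the span of the left translations, and its compression\<close>

definition embed :: "'s::left_cancel_monoid ell2 \<Rightarrow>\<^sub>L 's left_hull ell2" where
  "embed = op_on_basis (\<lambda>s. ket (translation_elem s))"

lemma embed:
  "embed \<in> bounded_ops" "blinfun_apply embed (ket s) = ket (translation_elem s)"
proof -
  have inj: "inj_on (\<lambda>s. Some (translation_elem s)) (dom (\<lambda>s. Some (translation_elem s)))"
    by (auto intro: inj_onI translation_elem_inject)
  show "embed \<in> bounded_ops" "blinfun_apply embed (ket s) = ket (translation_elem s)"
    unfolding embed_def by (rule op_on_basis_partial_inj[OF inj]; simp)+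
qed

lemma adj_embed_embed: "adj embed o\<^sub>L embed = id_blinfun"
proof (rule bounded_op_eqI)
  fix s :: 'a
  have "coord (blinfun_apply (adj embed) (ket (translation_elem s))) t = coord (ket s) t" for t
    using cinner_adj_right[OF embed(1), of "ket t" "ket (translation_elem s)"]
      translation_elem_inject
    by (auto simp: cinner_ket_left embed ket.rep_eq)
  then show "blinfun_apply (adj embed o\<^sub>L embed) (ket s) = blinfun_apply id_blinfun (ket s)"
    by (simp add: embed coord_inject[symmetric] fun_eq_iff)
qed (simp_all add: bounded_ops_comp bounded_ops_id adj_bounded_ops embed)

lemma norm_embed_le: "norm embed \<le> 1"
proof (rule norm_blinfun_bound)
  fix x :: "'a ell2"
  have "cinner (blinfun_apply embed x) (blinfun_apply embed x)
      = cinner x (blinfun_apply (adj embed o\<^sub>L embed) x)"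
    by (simp add: cinner_adj_right embed)
  then have "(norm (blinfun_apply embed x))\<^sup>2 = (norm x)\<^sup>2"
    unfolding adj_embed_embed cinner_self_norm by (simp add: cinner_self_norm del: of_real_power)
  then show "norm (blinfun_apply embed x) \<le> 1 * norm x" by simp
qed simp

definition compress ::
  "('s::left_cancel_monoid left_hull ell2 \<Rightarrow>\<^sub>L 's left_hull ell2) \<Rightarrow> ('s ell2 \<Rightarrow>\<^sub>L 's ell2)" where
  "compress T = adj embed o\<^sub>L T o\<^sub>L embed"

lemma embed_omega: "left_regular f o\<^sub>L embed = embed o\<^sub>L omega f"
proof (rule bounded_op_eqI)
  show "blinfun_apply (left_regular f o\<^sub>L embed) (ket s) = blinfun_apply (embed o\<^sub>L omega f) (ket s)" for s
    by (cases "pfun (pbij f) s") (simp_all add: embed(2) omega(2) left_regular_translation_elem)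
qed (intro bounded_ops_comp left_regular(1) embed(1) omega(1))+

lemma compress_left_regular: "compress (left_regular f) = omega f"
proof -
  have "compress (left_regular f) = (adj embed o\<^sub>L embed) o\<^sub>L omega f"
    unfolding compress_def blinfun_comp_assoc embed_omega ..
  also have "\<dots> = omega f" unfolding adj_embed_embed by (rule blinfun_eqI) simp
  finally show ?thesis .
qed

lemma norm_compress_le:
  fixes T :: "'s::left_cancel_monoid left_hull ell2 \<Rightarrow>\<^sub>L 's left_hull ell2"
  shows "norm (compress T) \<le> norm T"
proof -
  let ?U = "embed :: 's ell2 \<Rightarrow>\<^sub>L 's left_hull ell2"
  have "norm (compress T) \<le> norm (adj ?U o\<^sub>L T) * norm ?U"
    unfolding compress_def by (rule norm_blinfun_compose)
  also have "\<dots> \<le> norm (adj ?U) * norm T * norm ?U"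
    by (intro mult_right_mono norm_blinfun_compose norm_ge_zero)
  also have "\<dots> \<le> 1 * norm T * 1"
    using norm_embed_le order_trans[OF norm_adj_le[OF embed(1)] norm_embed_le]
    by (intro mult_mono) auto
  finally show ?thesis by simp
qed

lemma compress_add: "compress (T + U) = compress T + compress U"
  by (simp add: compress_def bounded_bilinear.add_left[OF bounded_bilinear_blinfun_compose]
      bounded_bilinear.add_right[OF bounded_bilinear_blinfun_compose])

lemma compress_scale: "compress (scale_op c T) = scale_op c (compress T)"
  by (simp add: compress_def scale_op_compose adj_bounded_ops embed)

lemma compress_zero: "compress 0 = 0"
  using compress_scale[of 0 0] by simp

lemma bounded_linear_compress: "bounded_linear compress"
  by (rule bounded_linear_intro[where K = 1])
     (use compress_scale[of "complex_of_real _"] in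
       \<open>simp_all add: compress_add norm_compress_le scale_op_of_real\<close>)

lemma compress_bounded_ops: "T \<in> bounded_ops \<Longrightarrow> compress T \<in> bounded_ops"
  by (simp add: compress_def bounded_ops_comp adj_bounded_ops embed)

lemma compress_adj: "T \<in> bounded_ops \<Longrightarrow> compress (adj T) = adj (compress T)"
  by (simp add: compress_def bounded_ops_comp adj_bounded_ops embed adj_comp adj_adj blinfun_comp_assoc)

text \<open>The range of \<open>embed\<close> is invariant under the whole algebra. For the
  generators this is \<open>embed_omega\<close>, and the relation defines a closed subspace. It is
  what makes the compression multiplicative.\<close>

lemma embed_compress:
  assumes "T \<in> reduced_cstar"
  shows "T o\<^sub>L embed = embed o\<^sub>L compress T"
proof -
  have "closed {T. T o\<^sub>L embed = embed o\<^sub>L compress T}"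
    by (intro closed_Collect_eq continuous_intros linear_continuous_on bounded_linear_compress)
  moreover have "op.span (range left_regular) \<subseteq> {T. T o\<^sub>L embed = embed o\<^sub>L compress T}"
  proof (rule op.span_minimal)
    show "range left_regular \<subseteq> {T. T o\<^sub>L embed = embed o\<^sub>L compress T}"
      by (auto simp: compress_left_regular embed_omega)
    show "op.subspace {T. T o\<^sub>L embed = embed o\<^sub>L compress T}"
      using bounded_bilinear.zero_right[OF bounded_bilinear_blinfun_compose]
        bounded_bilinear.zero_left[OF bounded_bilinear_blinfun_compose]
      by (auto simp: compress_zero op.subspace_def compress_add compress_scale scale_op_compose embed
        bounded_bilinear.add_left[OF bounded_bilinear_blinfun_compose]
        bounded_bilinear.add_right[OF bounded_bilinear_blinfun_compose])
  qed
  ultimately show ?thesis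
    using assms closure_minimal unfolding reduced_cstar_def by blast
qed

lemma compress_comp:
  assumes "U \<in> reduced_cstar"
  shows "compress (T o\<^sub>L U) = compress T o\<^sub>L compress U"
  by (simp add: compress_def[of T] compress_def[of "T o\<^sub>L U"] blinfun_comp_assoc embed_compress[OF assms])

text \<open>Translation by 1 is an identity of the hull, so the reduced algebra is unital, as
  \<open>contractive_hom\<close> demands.\<close>

lemma left_regular_unit: "left_regular (translation_elem 1) = id_blinfun"
proof -
  have m: "translation_elem 1 * q = q" for q :: "'a left_hull"
    by (rule pfun_eqI) (simp add: times_left_hull.rep_eq pfun_mult pfun_translation_elem split: option.split)
  show ?thesis
    by (rule bounded_op_eqI) (simp_all add: left_regular bounded_ops_id m star_idem)
qed

section \<open>The image of the compression\<close>

lemma omega_translation_elem: "omega (translation_elem s) = translation_op s"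
  by (rule bounded_op_eqI) (simp_all add: omega translation_op pfun_translation_elem)

lemma translation_op_one: "translation_op 1 = id_blinfun"
  by (rule bounded_op_eqI) (simp_all add: translation_op bounded_ops_id)

interpretation compress: contractive_hom reduced_cstar compress
proof
  show "concrete_cstar_algebra (reduced_cstar :: ('a left_hull ell2 \<Rightarrow>\<^sub>L _) set)"
    by (rule concrete_cstar_algebra_reduced_cstar)
  then have "reduced_cstar \<subseteq> (bounded_ops :: ('a left_hull ell2 \<Rightarrow>\<^sub>L _) set)"
    by (simp add: concrete_cstar_algebra_def)
  then show "star_hom (op_algebra reduced_cstar) (op_algebra bounded_ops)
      (compress :: ('a left_hull ell2 \<Rightarrow>\<^sub>L _) \<Rightarrow> _)"
    by (auto simp: star_hom_def op_algebra_def compress_bounded_ops compress_add compress_scale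
        compress_comp compress_adj subset_iff)
  show "id_blinfun \<in> (reduced_cstar :: ('a left_hull ell2 \<Rightarrow>\<^sub>L _) set)"
    using left_regular_mem[of "translation_elem 1"] by (simp add: left_regular_unit)
  show "compress id_blinfun = id_blinfun"
    using left_regular_unit compress_left_regular omega_translation_elem translation_op_one by metis
qed (rule norm_compress_le)

text \<open>Induction over the generation of the hull. Compatibility of \<open>omega\<close> with
  products and adjoints is inherited from \<open>left_regular\<close> through the
  compression.\<close>

lemma omega_mem_cstar:
  assumes A: "concrete_cstar_algebra A" "range translation_op \<subseteq> A"
  shows "omega f \<in> A"
proof -
  have "omega (Abs_left_hull g) \<in> A" if "g \<in> left_hull_set" for g
    using that
  proof (induction rule: left_hull_set.induct)
    case (translation s)
    show ?case using A(2) omega_translation_elem[of s] by (auto simp: translation_elem_def)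
  next
    case (mult f g)
    have "omega (Abs_left_hull f * Abs_left_hull g) = omega (Abs_left_hull f) o\<^sub>L omega (Abs_left_hull g)"
      by (simp add: left_regular_mult left_regular_mem compress_comp flip: compress_left_regular)
    moreover have "Abs_left_hull f * Abs_left_hull g = Abs_left_hull (f * g)"
      using mult by (simp add: times_left_hull.abs_eq eq_onp_same_args)
    ultimately show ?case using mult A(1) by (simp add: concrete_cstar_algebra_def)
  next
    case (star f)
    have "omega ((Abs_left_hull f)\<^sup>\<star>) = adj (omega (Abs_left_hull f))"
      by (simp add: left_regular_star left_regular(1) compress_adj flip: compress_left_regular)
    moreover have "(Abs_left_hull f)\<^sup>\<star> = Abs_left_hull (f\<^sup>\<star>)"
      using star by (simp add: star_left_hull.abs_eq eq_onp_same_args)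
    ultimately show ?case using star A(1) by (simp add: concrete_cstar_algebra_def)
  qed
  from this[OF pbij[of f]] show ?thesis by (simp add: pbij_inverse)
qed

text \<open>One inclusion holds because the image is a C*-algebra containing the translation
  operators; this is where its closedness is used. For the other, any C*-algebra containing them
  contains every \<open>omega f\<close>, and linearity and continuity do the rest.\<close>

lemma compress_image: "compress ` reduced_cstar = cstar_generated (range translation_op)"
proof
  have "range (translation_op :: 'a \<Rightarrow> _) \<subseteq> compress ` reduced_cstar"
    by (metis omega_translation_elem compress_left_regular image_eqI image_subsetI left_regular_mem)
  then show "cstar_generated (range (translation_op :: 'a \<Rightarrow> _)) \<subseteq> compress ` reduced_cstar"
    using compress.concrete_cstar_algebra_image by (auto simp: cstar_generated_def)
  have "compress ` reduced_cstar \<subseteq> A"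
    if A: "concrete_cstar_algebra A" "range (translation_op :: 'a \<Rightarrow> _) \<subseteq> A" for A
  proof -
    have "op.span (range left_regular) \<subseteq> compress -` A"
    proof (rule op.span_minimal)
      show "range left_regular \<subseteq> compress -` A"
        by (auto simp: compress_left_regular omega_mem_cstar[OF A])
      show "op.subspace (compress -` A)"
        using A(1) by (auto simp: compress_zero concrete_cstar_algebra_def op.subspace_def compress_add compress_scale)
    qed
    then show ?thesis
      unfolding reduced_cstar_def
      by (intro image_closure_subset linear_continuous_on bounded_linear_compress)
         (use A(1) in \<open>auto simp: concrete_cstar_algebra_def\<close>)
  qed
  then show "compress ` reduced_cstar \<subseteq> cstar_generated (range (translation_op :: 'a \<Rightarrow> _))"
    by (auto simp: cstar_generated_def)
qed

text \<open>Although \<open>left_regular\<close> of the empty map is a nonzero projection, onto the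
  line of its own basis vector, it compresses to \<open>omega\<close> of the empty map, which
  vanishes.\<close>

lemma compress_empty_map_ideal:
  assumes "T \<in> empty_map_ideal"
  shows "T \<in> reduced_cstar" "compress T = 0"
proof -
  have sub: "op.subspace (reduced_cstar :: ('a left_hull ell2 \<Rightarrow>\<^sub>L _) set)"
    using concrete_cstar_algebra_reduced_cstar by (auto simp: concrete_cstar_algebra_def)
  have "T \<in> reduced_cstar \<and> compress T = 0"
  proof (cases "(0 :: 'a partial_bij) \<in> left_hull_set")
    case True
    then obtain c where c: "T = scale_op c (left_regular (Abs_left_hull 0))"
      using assms by (auto simp: empty_map_ideal_def)
    have "omega (Abs_left_hull (0 :: 'a partial_bij)) = 0"
      by (rule bounded_op_eqI)
         (simp_all add: omega op.subspace_0[OF subspace_bounded_ops] True Abs_left_hull_inverse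
           zero_partial_bij.rep_eq)
    then show ?thesis
      by (simp add: c op.subspace_scale[OF sub] left_regular_mem compress_scale compress_left_regular)
  next
    case False
    then show ?thesis
      using assms op.subspace_0[OF sub] compress.hom_zero by (simp add: empty_map_ideal_def)
  qed
  then show "T \<in> reduced_cstar" "compress T = 0" by auto
qed

theorem corollary3p2p13:
  shows "\<exists>h :: ('s::left_cancel_monoid left_hull ell2 \<Rightarrow>\<^sub>L 's left_hull ell2) set \<Rightarrow>
           ('s ell2 \<Rightarrow>\<^sub>L 's ell2).
         surjective_star_hom hull_cstar0 semigroup_cstar h \<and>
         (\<forall>f. h (left_regular0 f) = omega f)"
proof -
  interpret q: star_hom_kernel "op_algebra reduced_cstar" semigroup_cstar empty_map_ideal
    "compress :: ('s left_hull ell2 \<Rightarrow>\<^sub>L 's left_hull ell2) \<Rightarrow> _"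
  proof
    \<comment> \<open>The interpretation gave values among all bounded operators;
      \<open>compress_image\<close> narrows the target to the generated algebra.\<close>
    show "star_hom (op_algebra reduced_cstar) semigroup_cstar
        (compress :: ('s left_hull ell2 \<Rightarrow>\<^sub>L 's left_hull ell2) \<Rightarrow> _)"
      using compress.hom
      by (auto simp: star_hom_def op_algebra_def semigroup_cstar_def simp flip: compress_image)
    show "(empty_map_ideal :: ('s left_hull ell2 \<Rightarrow>\<^sub>L _) set) \<noteq> {}"
      by (auto simp: empty_map_ideal_def)
  qed (auto simp: op_algebra_def compress_empty_map_ideal compress_add
      op.subspace_add[OF compress.algebra(2)] op.subspace_scale[OF compress.algebra(2)]
      compress.algebra(4,5))
  have "q.quot ` elems hull_cstar0 = elems semigroup_cstar"
    unfolding hull_cstar0_def q.quot_image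
    by (simp add: op_algebra_def semigroup_cstar_def compress_image)
  moreover have "q.quot (left_regular0 f) = omega f" for f
    using q.quot_coset[of "left_regular f"]
    by (simp add: left_regular0_def left_regular_mem compress_left_regular)
       (simp add: op_algebra_def left_regular_mem)
  ultimately show ?thesis
    using q.star_hom_quot unfolding surjective_star_hom_def hull_cstar0_def by blast
qed

end
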